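(* Let $i:M\to N$ be a nondegenerate mean curvature zero Lagrangian immersion of the $n$-manifold $M$ in the $2n$-dimensional (para/pseudo-)Kähler manifold $(N,G,\Omega,A)$ with constant (para)-holomorphic sectional curvature $4\hat c$, where $A^2=\epsilon\,\mathrm{Id}$ with $\epsilon\in\{\pm1\}$. Let $h=i^*(G)$ be the induced metric and let $\Pi\in\Gamma(S^3(T^*M))$ be the tensor defined from the second fundamental form of $i$ by $$\Pi(X,Y,Z)=\Omega(\hat\nabla_XTi(Y),Ti(Z)),\qquad X,Y,Z\in\Gamma(TM),$$ where $\hat\nabla$ is the Levi-Civita connection of $G$. Then $(h,\Pi)$ solves the coupled projectively flat equations with $c=\epsilon$ and $\kappa=\hat c\,n(n-1)$.
   Context: Here $n\geq 2$. A (para/pseudo)-Kähler structure is a triple $(G,A,\Omega)$ of a pseudo-Riemannian metric $G$, an integrable complex ($\epsilon=-1$) or para-complex ($\epsilon=1$) structure $A$, and a symplectic form $\Omega$ such that $A(AX)=\epsilon X$, $\Omega(X,Y)=G(AX,Y)$, $\Omega(AX,Y)=\epsilon G(X,Y)$. In particular $A$ is parallel for the Levi-Civita connection $\hat\nabla$ of $G$. Curvature conventions: for the Levi-Civita connection $D$ of a metric $h$, $D_iD_j\alpha_k-D_jD_i\alpha_k=-R_{ijk}{}^p\alpha_p$ for one-forms $\alpha$, and $\mathrm{Riem}_{ijkl}=R_{ijk}{}^ph_{pl}$. For a symmetric $k$-tensor $\omega$, $k\geq2$, $(\omega\circledast\omega)_{ijkl}=\omega_{ki}{}^A\omega_{jlA}-\omega_{kj}{}^A\omega_{ilA}$,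 where $A=a_1\dots a_{k-2}$ is a contracted multi-index (indices raised with $h$), and $(h\circledast h)_{ijkl}=h_{ki}h_{jl}-h_{kj}h_{il}$. For a two-form $\alpha$, $(\alpha\cdot\alpha)_{ijkl}=\frac13\left(\alpha_{ki}\alpha_{jl}-\alpha_{kj}\alpha_{il}-2\alpha_{ij}\alpha_{kl}\right)$. $(N,G,A)$ has constant (para)-holomorphic sectional curvature $4\hat c$ if its curvature tensor is $\widehat{\mathrm{Riem}}=-\hat c\,(G\circledast G+3\epsilon\,\Omega\cdot\Omega)$. The immersion is Lagrangian if $i^*\Omega=0$, and nondegenerate if $h=i^*(G)$ is nondegenerate. The tensor $\Pi$ is completely symmetric, and mean curvature zero means $h^{jk}\Pi_{ijk}=0$. A pair $(h,\omega)$ with $\omega\in\Gamma(S^3(T^*M))$ solves the coupled projectively flat equations with constants $c,\kappa\in\mathbb{R}$ if $\omega$ is $h$-trace-free, Codazzi, meaning $D_i\omega_{jkl}=D_j\omega_{ikl}$ (hence also divergence free), and $\mathrm{Riem}-c(\omega\circledast\omega)=-\frac{\kappa}{n(n-1)}h\circledast h$. *)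

theory Defs
  imports "HOL-Analysis.Analysis"
begin

text \<open>
  Manifolds are topological spaces with an atlas of charts into the space of \<open>'n\<close>-tuples, so
  that the dimension is \<open>CARD('n)\<close>. Tensor fields are families of component functions, one for each
  chart, related by the usual transformation law. The components for a chart \<open>c\<close> are functions of
  the coordinates, i.e. of points of \<open>chart_image c\<close>; their values elsewhere are irrelevant.
\<close>

section \<open>Smooth functions between coordinate spaces\<close>

definition pd :: "'n \<Rightarrow> (real^'n \<Rightarrow> real) \<Rightarrow> real^'n \<Rightarrow> real" where
  "pd i f x = frechet_derivative f (at x) (axis i 1)"

text \<open>Only used for open \<open>S\<close>. All iterated partial derivatives exist and are differentiable,
  hence continuous: this is \<open>C\<close>-infinity smoothness on \<open>S\<close>.\<close>

definition smooth_on :: "(real^'n) set \<Rightarrow> (real^'n \<Rightarrow> real) \<Rightarrow> bool" where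
  "smooth_on S f \<longleftrightarrow> (\<forall>is. \<forall>x\<in>S. foldr pd is f differentiable (at x))"

definition smooth_vec_on :: "(real^'n) set \<Rightarrow> (real^'n \<Rightarrow> real^'m) \<Rightarrow> bool" where
  "smooth_vec_on S F \<longleftrightarrow> (\<forall>a. smooth_on S (\<lambda>x. F x $ a))"


section \<open>Manifolds, smooth maps, immersions\<close>

type_synonym ('a, 'n) chart = "'a set \<times> ('a \<Rightarrow> real^'n)"
type_synonym ('a, 'n) atlas = "('a, 'n) chart set"

definition chart_image :: "('a, 'n::finite) chart \<Rightarrow> (real^'n) set" where
  "chart_image c = snd c ` fst c"

definition coord_rep :: "('a \<Rightarrow> 'b) \<Rightarrow> ('a, 'n::finite) chart \<Rightarrow> ('b, 'm::finite) chart \<Rightarrow> real^'n \<Rightarrow> real^'m" where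
  "coord_rep f c d = snd d \<circ> f \<circ> inv_into (fst c) (snd c)"

definition coord_dom :: "('a \<Rightarrow> 'b) \<Rightarrow> ('a, 'n::finite) chart \<Rightarrow> ('b, 'm::finite) chart \<Rightarrow> (real^'n) set" where
  "coord_dom f c d = snd c ` (fst c \<inter> f -` fst d)"

definition smooth_manifold :: "'a topology \<Rightarrow> ('a, 'n::finite) atlas \<Rightarrow> bool" where
  "smooth_manifold X \<A> \<longleftrightarrow>
     Hausdorff_space X \<and> second_countable X \<and> (\<Union>c\<in>\<A>. fst c) = topspace X \<and>
     (\<forall>c\<in>\<A>. openin X (fst c) \<and> open (chart_image c) \<and>
        homeomorphic_map (subtopology X (fst c)) (top_of_set (chart_image c)) (snd c)) \<and>
     (\<forall>c\<in>\<A>. \<forall>d\<in>\<A>. smooth_vec_on (coord_dom id c d) (coord_rep id c d))"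

definition smooth_map ::
  "'a topology \<Rightarrow> ('a, 'n::finite) atlas \<Rightarrow> 'b topology \<Rightarrow> ('b, 'm::finite) atlas \<Rightarrow> ('a \<Rightarrow> 'b) \<Rightarrow> bool" where
  "smooth_map X \<A> Y \<B> f \<longleftrightarrow> continuous_map X Y f \<and>
     (\<forall>c\<in>\<A>. \<forall>d\<in>\<B>. smooth_vec_on (coord_dom f c d) (coord_rep f c d))"

definition immersion ::
  "'a topology \<Rightarrow> ('a, 'n::finite) atlas \<Rightarrow> 'b topology \<Rightarrow> ('b, 'm::finite) atlas \<Rightarrow> ('a \<Rightarrow> 'b) \<Rightarrow> bool" where
  "immersion X \<A> Y \<B> f \<longleftrightarrow> smooth_map X \<A> Y \<B> f \<and>
     (\<forall>c\<in>\<A>. \<forall>d\<in>\<B>. \<forall>x\<in>coord_dom f c d. inj ((*v) (jacobian (coord_rep f c d) (at x))))"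


section \<open>Tensor fields\<close>

text \<open>A covariant 2-tensor \<open>T\<close> has the components \<open>T c x $ i $ j\<close>. An endomorphism field \<open>A\<close> acts on
  tangent vectors by \<open>A c x *v v\<close>, so that its upper index is the first one.\<close>

type_synonym ('a, 'n) tensor2 = "('a, 'n) chart \<Rightarrow> real^'n \<Rightarrow> real^'n^'n"
type_synonym ('a, 'n) tensor3 = "('a, 'n) chart \<Rightarrow> real^'n \<Rightarrow> 'n \<Rightarrow> 'n \<Rightarrow> 'n \<Rightarrow> real"

definition smooth_comps2 :: "('a, 'n::finite) atlas \<Rightarrow> ('a, 'n) tensor2 \<Rightarrow> bool" where
  "smooth_comps2 \<A> T \<longleftrightarrow> (\<forall>c\<in>\<A>. \<forall>i j. smooth_on (chart_image c) (\<lambda>x. T c x $ i $ j))"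

definition is_pullback2 ::
  "('a, 'n::finite) atlas \<Rightarrow> ('b, 'm::finite) atlas \<Rightarrow> ('a \<Rightarrow> 'b) \<Rightarrow> ('b, 'm) tensor2 \<Rightarrow> ('a, 'n) tensor2 \<Rightarrow> bool" where
  "is_pullback2 \<A> \<B> f T S \<longleftrightarrow> (\<forall>c\<in>\<A>. \<forall>d\<in>\<B>. \<forall>x\<in>coord_dom f c d.
     let J = jacobian (coord_rep f c d) (at x)
     in S c x = transpose J ** T d (coord_rep f c d x) ** J)"

text \<open>The transformation law says that the components are compatible under pullback by the
  identity map.\<close>

definition cov2_field :: "('a, 'n::finite) atlas \<Rightarrow> ('a, 'n) tensor2 \<Rightarrow> bool" where
  "cov2_field \<A> T \<longleftrightarrow> smooth_comps2 \<A> T \<and> is_pullback2 \<A> \<A> id T T"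

definition endo_field :: "('a, 'n::finite) atlas \<Rightarrow> ('a, 'n) tensor2 \<Rightarrow> bool" where
  "endo_field \<A> A \<longleftrightarrow> smooth_comps2 \<A> A \<and> (\<forall>c\<in>\<A>. \<forall>d\<in>\<A>. \<forall>x\<in>coord_dom id c d.
     let J = jacobian (coord_rep id c d) (at x)
     in J ** A c x = A d (coord_rep id c d x) ** J)"

definition cov3_field :: "('a, 'n::finite) atlas \<Rightarrow> ('a, 'n) tensor3 \<Rightarrow> bool" where
  "cov3_field \<A> T \<longleftrightarrow>
     (\<forall>c\<in>\<A>. \<forall>i j k. smooth_on (chart_image c) (\<lambda>x. T c x i j k)) \<and>
     (\<forall>c\<in>\<A>. \<forall>d\<in>\<A>. \<forall>x\<in>coord_dom id c d. \<forall>i j k.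
        let J = jacobian (coord_rep id c d) (at x)
        in T c x i j k =
           (\<Sum>p\<in>UNIV. \<Sum>q\<in>UNIV. \<Sum>r\<in>UNIV.
              T d (coord_rep id c d x) p q r * J $ p $ i * J $ q $ j * J $ r $ k))"

definition sym3_field :: "('a, 'n::finite) atlas \<Rightarrow> ('a, 'n) tensor3 \<Rightarrow> bool" where
  "sym3_field \<A> T \<longleftrightarrow> cov3_field \<A> T \<and>
     (\<forall>c\<in>\<A>. \<forall>x\<in>chart_image c. \<forall>i j k. T c x i j k = T c x j i k \<and> T c x i j k = T c x i k j)"


section \<open>Metrics, Levi-Civita connection, curvature\<close>

definition nondegenerate2 :: "('a, 'n::finite) atlas \<Rightarrow> ('a, 'n) tensor2 \<Rightarrow> bool" where
  "nondegenerate2 \<A> T \<longleftrightarrow> (\<forall>c\<in>\<A>. \<forall>x\<in>chart_image c. invertible (T c x))"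

definition pseudo_riemannian_metric :: "('a, 'n::finite) atlas \<Rightarrow> ('a, 'n) tensor2 \<Rightarrow> bool" where
  "pseudo_riemannian_metric \<A> g \<longleftrightarrow> cov2_field \<A> g \<and> nondegenerate2 \<A> g \<and>
     (\<forall>c\<in>\<A>. \<forall>x\<in>chart_image c. transpose (g c x) = g c x)"

text \<open>The following operate on the components of a metric in a fixed chart;
  \<open>christoffel g x p i j\<close> is the Christoffel symbol with upper index \<open>p\<close> and lower indices
  \<open>i\<close>, \<open>j\<close>.\<close>

definition christoffel :: "(real^'n \<Rightarrow> real^'n^'n) \<Rightarrow> real^'n \<Rightarrow> 'n \<Rightarrow> 'n \<Rightarrow> 'n \<Rightarrow> real" where
  "christoffel g x p i j = (1/2) * (\<Sum>q\<in>UNIV. matrix_inv (g x) $ p $ q *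
     (pd i (\<lambda>y. g y $ j $ q) x + pd j (\<lambda>y. g y $ i $ q) x - pd q (\<lambda>y. g y $ i $ j) x))"

text \<open>\<open>curv g x i j k p\<close> is the component of the curvature with lower indices \<open>i\<close>, \<open>j\<close>, \<open>k\<close> and upper
  index \<open>p\<close>. The Ricci identity in this convention is \<open>D\<^sub>i D\<^sub>j \<alpha>\<^sub>k - D\<^sub>j D\<^sub>i \<alpha>\<^sub>k = - R\<^sub>i\<^sub>j\<^sub>k\<^sup>p \<alpha>\<^sub>p\<close> for one-forms,
  equivalently \<open>D\<^sub>i D\<^sub>j X\<^sup>p - D\<^sub>j D\<^sub>i X\<^sup>p = R\<^sub>i\<^sub>j\<^sub>k\<^sup>p X\<^sup>k\<close> for vector fields.\<close>

definition curv :: "(real^'n \<Rightarrow> real^'n^'n) \<Rightarrow> real^'n \<Rightarrow> 'n \<Rightarrow> 'n \<Rightarrow> 'n \<Rightarrow> 'n \<Rightarrow> real" where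
  "curv g x i j k p =
     pd i (\<lambda>y. christoffel g y p j k) x - pd j (\<lambda>y. christoffel g y p i k) x +
     (\<Sum>q\<in>UNIV. christoffel g x p i q * christoffel g x q j k -
                christoffel g x p j q * christoffel g x q i k)"

definition Riem :: "(real^'n \<Rightarrow> real^'n^'n) \<Rightarrow> real^'n \<Rightarrow> 'n \<Rightarrow> 'n \<Rightarrow> 'n \<Rightarrow> 'n \<Rightarrow> real" where
  "Riem g x i j k l = (\<Sum>p\<in>UNIV. curv g x i j k p * g x $ p $ l)"

text \<open>\<open>cov_deriv3 g \<omega> x i j k l\<close> is \<open>D\<^sub>i \<omega>\<^sub>j\<^sub>k\<^sub>l\<close>.\<close>

definition cov_deriv3 ::
  "(real^'n \<Rightarrow> real^'n^'n) \<Rightarrow> (real^'n \<Rightarrow> 'n \<Rightarrow> 'n \<Rightarrow> 'n \<Rightarrow> real) \<Rightarrow>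
   real^'n \<Rightarrow> 'n \<Rightarrow> 'n \<Rightarrow> 'n \<Rightarrow> 'n \<Rightarrow> real" where
  "cov_deriv3 g \<omega> x i j k l = pd i (\<lambda>y. \<omega> y j k l) x -
     (\<Sum>p\<in>UNIV. christoffel g x p i j * \<omega> x p k l + christoffel g x p i k * \<omega> x j p l +
                christoffel g x p i l * \<omega> x j k p)"

text \<open>The products \<open>h \<circledast> h\<close>, \<open>\<omega> \<circledast> \<omega>\<close> (for a 3-tensor \<open>\<omega>\<close>, with respect to the metric \<open>h\<close>) and
  \<open>\<alpha> \<cdot> \<alpha>\<close> (for a two-form \<open>\<alpha>\<close>), at a point.\<close>

definition metric_square :: "real^'n^'n \<Rightarrow> 'n \<Rightarrow> 'n \<Rightarrow> 'n \<Rightarrow> 'n \<Rightarrow> real" where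
  "metric_square h i j k l = h $ k $ i * h $ j $ l - h $ k $ j * h $ i $ l"

definition cubic_square ::
  "real^'n^'n \<Rightarrow> ('n \<Rightarrow> 'n \<Rightarrow> 'n \<Rightarrow> real) \<Rightarrow> 'n \<Rightarrow> 'n \<Rightarrow> 'n \<Rightarrow> 'n \<Rightarrow> real" where
  "cubic_square h \<omega> i j k l = (\<Sum>a\<in>UNIV. \<Sum>b\<in>UNIV. matrix_inv h $ a $ b *
     (\<omega> k i a * \<omega> j l b - \<omega> k j a * \<omega> i l b))"

definition form_square :: "real^'n^'n \<Rightarrow> 'n \<Rightarrow> 'n \<Rightarrow> 'n \<Rightarrow> 'n \<Rightarrow> real" where
  "form_square \<alpha> i j k l = (1/3) *
     (\<alpha> $ k $ i * \<alpha> $ j $ l - \<alpha> $ k $ j * \<alpha> $ i $ l - 2 * \<alpha> $ i $ j * \<alpha> $ k $ l)"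

definition trace_free3 :: "('a, 'n::finite) atlas \<Rightarrow> ('a, 'n) tensor2 \<Rightarrow> ('a, 'n) tensor3 \<Rightarrow> bool" where
  "trace_free3 \<A> h \<omega> \<longleftrightarrow> (\<forall>c\<in>\<A>. \<forall>x\<in>chart_image c. \<forall>i.
     (\<Sum>j\<in>UNIV. \<Sum>k\<in>UNIV. matrix_inv (h c x) $ j $ k * \<omega> c x i j k) = 0)"


section \<open>(Para/pseudo)-Kaehler structures\<close>

definition symplectic_form :: "('a, 'n::finite) atlas \<Rightarrow> ('a, 'n) tensor2 \<Rightarrow> bool" where
  "symplectic_form \<A> \<Omega> \<longleftrightarrow> cov2_field \<A> \<Omega> \<and> nondegenerate2 \<A> \<Omega> \<and>
     (\<forall>c\<in>\<A>. \<forall>x\<in>chart_image c. transpose (\<Omega> c x) = - \<Omega> c x \<and>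
        (\<forall>i j k. pd i (\<lambda>y. \<Omega> c y $ j $ k) x + pd j (\<lambda>y. \<Omega> c y $ k $ i) x +
                 pd k (\<lambda>y. \<Omega> c y $ i $ j) x = 0))"

text \<open>The upper component \<open>k\<close> of the Nijenhuis tensor
  \<open>[AX, AY] - A[AX, Y] - A[X, AY] + A\<^sup>2[X, Y]\<close> on the coordinate fields with indices \<open>i\<close>, \<open>j\<close>, for
  an endomorphism field \<open>A\<close> given in a fixed chart.\<close>

definition nijenhuis :: "(real^'n \<Rightarrow> real^'n^'n) \<Rightarrow> real^'n \<Rightarrow> 'n \<Rightarrow> 'n \<Rightarrow> 'n \<Rightarrow> real" where
  "nijenhuis A x k i j = (\<Sum>l\<in>UNIV.
     A x $ l $ i * pd l (\<lambda>y. A y $ k $ j) x - A x $ l $ j * pd l (\<lambda>y. A y $ k $ i) x +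
     A x $ k $ l * pd j (\<lambda>y. A y $ l $ i) x - A x $ k $ l * pd i (\<lambda>y. A y $ l $ j) x)"

definition integrable_structure :: "('a, 'n::finite) atlas \<Rightarrow> real \<Rightarrow> ('a, 'n) tensor2 \<Rightarrow> bool" where
  "integrable_structure \<A> \<epsilon> A \<longleftrightarrow> endo_field \<A> A \<and>
     (\<forall>c\<in>\<A>. \<forall>x\<in>chart_image c. A c x ** A c x = \<epsilon> *\<^sub>R mat 1 \<and>
        (\<forall>i j k. nijenhuis (A c) x k i j = 0))"

text \<open>The last two conditions are \<open>\<Omega>(X,Y) = G(AX,Y)\<close> and \<open>\<Omega>(AX,Y) = \<epsilon> G(X,Y)\<close>. For \<open>\<epsilon> = 1\<close> they
  force the two eigenbundles of \<open>A\<close> to be \<open>G\<close>-isotropic, hence of equal rank.\<close>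

definition kaehler_structure ::
  "('a, 'n::finite) atlas \<Rightarrow> real \<Rightarrow> ('a, 'n) tensor2 \<Rightarrow> ('a, 'n) tensor2 \<Rightarrow> ('a, 'n) tensor2 \<Rightarrow> bool" where
  "kaehler_structure \<A> \<epsilon> G A \<Omega> \<longleftrightarrow>
     pseudo_riemannian_metric \<A> G \<and> integrable_structure \<A> \<epsilon> A \<and> symplectic_form \<A> \<Omega> \<and>
     (\<forall>c\<in>\<A>. \<forall>x\<in>chart_image c.
        (\<forall>X Y. X \<bullet> (\<Omega> c x *v Y) = (A c x *v X) \<bullet> (G c x *v Y)) \<and>
        (\<forall>X Y. (A c x *v X) \<bullet> (\<Omega> c x *v Y) = \<epsilon> * (X \<bullet> (G c x *v Y))))"

text \<open>Constant (para)-holomorphic sectional curvature \<open>4 * C\<close>.\<close>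

definition const_hol_sec_curv ::
  "('a, 'n::finite) atlas \<Rightarrow> real \<Rightarrow> ('a, 'n) tensor2 \<Rightarrow> ('a, 'n) tensor2 \<Rightarrow> real \<Rightarrow> bool" where
  "const_hol_sec_curv \<A> \<epsilon> G \<Omega> C \<longleftrightarrow> (\<forall>c\<in>\<A>. \<forall>x\<in>chart_image c. \<forall>i j k l.
     Riem (G c) x i j k l =
       - C * (metric_square (G c x) i j k l + 3 * \<epsilon> * form_square (\<Omega> c x) i j k l))"


section \<open>Lagrangian immersions\<close>

definition lagrangian ::
  "('a, 'n::finite) atlas \<Rightarrow> ('b, 'm::finite) atlas \<Rightarrow> ('b, 'm) tensor2 \<Rightarrow> ('a \<Rightarrow> 'b) \<Rightarrow> bool" where
  "lagrangian \<A> \<B> \<Omega> f \<longleftrightarrow> is_pullback2 \<A> \<B> f \<Omega> (\<lambda>c x. 0)"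

text \<open>For a map \<open>F\<close> in coordinates, \<open>push F Y\<close> is the vector field \<open>TF(Y)\<close> along \<open>F\<close>, and
  \<open>cov_deriv_along G F X V\<close> is the derivative of a vector field \<open>V\<close> along \<open>F\<close> in the direction
  \<open>X\<close>, for the pullback along \<open>F\<close> of the Levi-Civita connection of \<open>G\<close>.\<close>

definition push :: "(real^'n \<Rightarrow> real^'m) \<Rightarrow> (real^'n \<Rightarrow> real^'n) \<Rightarrow> real^'n \<Rightarrow> real^'m" where
  "push F Y x = jacobian F (at x) *v Y x"

definition cov_deriv_along ::
  "(real^'m \<Rightarrow> real^'m^'m) \<Rightarrow> (real^'n \<Rightarrow> real^'m) \<Rightarrow> (real^'n \<Rightarrow> real^'n) \<Rightarrow> (real^'n \<Rightarrow> real^'m) \<Rightarrow>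
   real^'n \<Rightarrow> real^'m" where
  "cov_deriv_along G F X V x = (\<chi> a.
     (\<Sum>i\<in>UNIV. X x $ i * pd i (\<lambda>y. V y $ a) x) +
     (\<Sum>b\<in>UNIV. \<Sum>e\<in>UNIV. christoffel G (F x) a b e * push F X x $ b * V x $ e))"

text \<open>\<open>\<Pi>(X,Y,Z) = \<Omega>(\<nabla>\<^sub>X Ti(Y), Ti(Z))\<close> for all vector fields \<open>X\<close>, \<open>Y\<close>, \<open>Z\<close> on chart domains, where
  the right side is computed in an arbitrary chart of the target. Symmetry of \<open>\<Pi>\<close> and the
  transformation law of its components are not presupposed.\<close>

definition is_second_fundamental_tensor ::
  "('a, 'n::finite) atlas \<Rightarrow> ('b, 'm::finite) atlas \<Rightarrow> ('b, 'm) tensor2 \<Rightarrow> ('b, 'm) tensor2 \<Rightarrow> ('a \<Rightarrow> 'b) \<Rightarrow>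
   ('a, 'n) tensor3 \<Rightarrow> bool" where
  "is_second_fundamental_tensor \<A> \<B> G \<Omega> f P \<longleftrightarrow>
     (\<forall>c\<in>\<A>. \<forall>d\<in>\<B>. \<forall>X Y Z.
        smooth_vec_on (chart_image c) X \<longrightarrow> smooth_vec_on (chart_image c) Y \<longrightarrow>
        smooth_vec_on (chart_image c) Z \<longrightarrow>
        (\<forall>x\<in>coord_dom f c d. let F = coord_rep f c d in
           (\<Sum>i\<in>UNIV. \<Sum>j\<in>UNIV. \<Sum>k\<in>UNIV. P c x i j k * X x $ i * Y x $ j * Z x $ k) =
           cov_deriv_along (G d) F X (push F Y) x \<bullet> (\<Omega> d (F x) *v push F Z x)))"


section \<open>The coupled projectively flat equations\<close>

definition coupled_projectively_flat ::
  "('a, 'n::finite) atlas \<Rightarrow> ('a, 'n) tensor2 \<Rightarrow> ('a, 'n) tensor3 \<Rightarrow> real \<Rightarrow> real \<Rightarrow> bool" where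
  "coupled_projectively_flat \<A> h \<omega> C \<kappa> \<longleftrightarrow>
     pseudo_riemannian_metric \<A> h \<and> sym3_field \<A> \<omega> \<and> trace_free3 \<A> h \<omega> \<and>
     (\<forall>c\<in>\<A>. \<forall>x\<in>chart_image c. \<forall>i j k l.
        cov_deriv3 (h c) (\<omega> c) x i j k l = cov_deriv3 (h c) (\<omega> c) x j i k l) \<and>
     (\<forall>c\<in>\<A>. \<forall>x\<in>chart_image c. \<forall>i j k l.
        Riem (h c) x i j k l - C * cubic_square (h c x) (\<omega> c x) i j k l =
          - (\<kappa> / (real CARD('n) * (real CARD('n) - 1))) * metric_square (h c x) i j k l)"

end

theory Submission
  imports Defs
begin

text \<open>
  In a chart of \<open>M\<close> and a chart of \<open>N\<close> the immersion is a map \<open>F\<close> between coordinate spaces, with tangent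
  frame \<open>F\<^sub>i = \<partial>\<^sub>i F\<close>. Let \<open>\<nabla>\<^sub>i\<close> be the pullback along \<open>F\<close> of the Levi-Civita connection of \<open>G\<close>. The proof
  uses four of its properties: \<open>\<nabla>\<^sub>i F\<^sub>j = \<nabla>\<^sub>j F\<^sub>i\<close>; the product rule for the pairing of two fields by a parallel
  tensor; the Ricci identity \<open>\<nabla>\<^sub>i \<nabla>\<^sub>j V - \<nabla>\<^sub>j \<nabla>\<^sub>i V = R(F\<^sub>i, F\<^sub>j) V\<close>; and that both \<open>G\<close> and \<open>\<Omega>\<close> are parallel. The
  parallelism of \<open>\<Omega>\<close> is where the closedness of \<open>\<Omega>\<close> and the integrability of \<open>A\<close> enter: together with the
  compatibility of \<open>\<nabla>\<Omega>\<close> with \<open>A\<close> they leave no room for a nonzero \<open>\<nabla>\<Omega>\<close> (\<open>closed_integrable_imp_zero\<close>,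
  \<open>form_parallel\<close>).

  Because \<open>F\<close> is Lagrangian, \<open>A\<close> maps tangent vectors to normal vectors, and since \<open>h\<close> is nondegenerate and
  \<open>dim N = 2 dim M\<close>, the vectors \<open>F\<^sub>p\<close> and \<open>A F\<^sub>p\<close> span the tangent space of \<open>N\<close>. Pairing with them gives
  \<open>\<nabla>\<^sub>i F\<^sub>j = \<Gamma>\<^sub>i\<^sub>j\<^sup>p F\<^sub>p + \<epsilon> \<Pi>\<^sub>i\<^sub>j\<^sup>p A F\<^sub>p\<close>, where \<open>\<Gamma>\<close> is the Christoffel symbol of \<open>h\<close> (\<open>frame_decomposition\<close>). Now
  differentiate \<open>G(\<nabla>\<^sub>j F\<^sub>k, F\<^sub>l) = \<Gamma>\<^sub>j\<^sub>k\<^sub>l\<close> and \<open>\<Omega>(\<nabla>\<^sub>j F\<^sub>k, F\<^sub>l) = \<Pi>\<^sub>j\<^sub>k\<^sub>l\<close> in the direction \<open>i\<close> and antisymmetrize in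
  \<open>i\<close>, \<open>j\<close>. The second derivatives combine to the ambient curvature on tangent vectors. There all terms
  with \<open>\<Omega>\<close> in the formula for constant holomorphic curvature vanish, so what is left is the curvature of
  a space form: it is tangential, hence \<open>\<Omega>\<close>-orthogonal to the tangent space, and its pairing by \<open>G\<close> is
  \<open>-chat h \<circledast> h\<close>. The remaining terms \<open>G(\<nabla>\<^sub>j F\<^sub>k, \<nabla>\<^sub>i F\<^sub>l)\<close> and \<open>\<Omega>(\<nabla>\<^sub>j F\<^sub>k, \<nabla>\<^sub>i F\<^sub>l)\<close> are evaluated with the
  decomposition. The first identity becomes the curvature equation, with the factor
  \<open>\<epsilon>\<close> in front of \<open>\<Pi> \<circledast> \<Pi>\<close> produced by \<open>\<epsilon>\<^sup>2 G(A F\<^sub>p, A F\<^sub>q) = - \<epsilon> h\<^sub>p\<^sub>q\<close> (\<open>gauss_equation\<close>); the second becomes the Codazzi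
  condition (\<open>codazzi_equation\<close>). Symmetry of \<open>\<Pi>\<close> follows from torsion-freeness and from
  \<open>\<partial>\<^sub>i \<Omega>(F\<^sub>j, F\<^sub>k) = 0\<close>, and trace-freeness is the mean curvature hypothesis.

  The equations are local, so that it remains to see that \<open>h\<close> and \<open>\<Pi>\<close> are smooth tensor fields. Under a
  change of coordinates the second derivatives of the transition map contribute a tangential term to
  \<open>\<nabla>\<^sub>i F\<^sub>j\<close>, which \<open>\<Omega>\<close> annihilates (\<open>second_fundamental_transform\<close>).

  Tensors at a point are written as multilinear functions of vectors instead of arrays of components.
  An identity between them is checked on coordinate vectors and extended by \<open>linear_eq_axis\<close>, one
  argument at a time.
\<close>

section \<open>Partial derivatives\<close>

lemma pd_has_derivative:
  "(f has_derivative f') (at x) \<Longrightarrow> pd i f x = f' (axis i 1)"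
  unfolding pd_def by (metis frechet_derivative_at)

lemma pd_const [simp]: "pd i (\<lambda>_. c) = (\<lambda>_. 0)"
  by (rule ext) (rule pd_has_derivative, rule has_derivative_const)

lemma pd_add:
  assumes "f differentiable (at x)" "g differentiable (at x)"
  shows "pd i (\<lambda>y. f y + g y) x = pd i f x + pd i g x"
proof -
  have "((\<lambda>y. f y + g y) has_derivative
      (\<lambda>v. frechet_derivative f (at x) v + frechet_derivative g (at x) v)) (at x)"
    using assms by (intro has_derivative_add) (auto simp: frechet_derivative_works[symmetric])
  from pd_has_derivative[OF this] show ?thesis by (simp add: pd_def)
qed

lemma pd_mult:
  assumes "f differentiable (at x)" "g differentiable (at x)"
  shows "pd i (\<lambda>y. f y * g y) x = pd i f x * g x + f x * pd i g x"
proof -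
  have "((\<lambda>y. f y * g y) has_derivative
      (\<lambda>v. f x * frechet_derivative g (at x) v + frechet_derivative f (at x) v * g x)) (at x)"
    using assms by (intro has_derivative_mult) (auto simp: frechet_derivative_works[symmetric])
  from pd_has_derivative[OF this] show ?thesis by (simp add: pd_def)
qed

lemma pd_cmult:
  assumes "f differentiable (at x)"
  shows "pd i (\<lambda>y. c * f y) x = c * pd i f x"
  using pd_mult[of "\<lambda>_. c" x f i] assms by simp

lemma pd_minus:
  assumes "f differentiable (at x)"
  shows "pd i (\<lambda>y. - f y) x = - pd i f x"
  using pd_cmult[of f x i "-1"] assms by simp

lemma pd_sum:
  assumes "\<And>a. a \<in> I \<Longrightarrow> f a differentiable (at x)"
  shows "pd i (\<lambda>y. \<Sum>a\<in>I. f a y) x = (\<Sum>a\<in>I. pd i (f a) x)"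
  by (rule pd_has_derivative[of _ "\<lambda>v. \<Sum>a\<in>I. frechet_derivative (f a) (at x) v", unfolded pd_def[symmetric]])
     (use assms in \<open>auto intro!: has_derivative_sum simp: frechet_derivative_works[symmetric]\<close>)

lemma has_derivative_pd:
  fixes f :: "real^'n \<Rightarrow> real"
  assumes "f differentiable (at x)"
  shows "(f has_derivative (\<lambda>v. \<Sum>i\<in>UNIV. v $ i * pd i f x)) (at x)"
proof -
  let ?D = "frechet_derivative f (at x)"
  have D: "(f has_derivative ?D) (at x)" using assms by (simp add: frechet_derivative_works)
  then have l: "linear ?D" by (rule has_derivative_linear)
  have "?D v = (\<Sum>i\<in>UNIV. v $ i * pd i f x)" for v
  proof -
    have "?D v = ?D (\<Sum>i\<in>UNIV. v $ i *\<^sub>R axis i 1)"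
      using basis_expansion[of v] by (simp add: scalar_mult_eq_scaleR)
    then show ?thesis
      by (simp add: linear_sum[OF l] linear_cmul[OF l] pd_def)
  qed
  then have "?D = (\<lambda>v. \<Sum>i\<in>UNIV. v $ i * pd i f x)" by (rule ext)
  then show ?thesis using D by metis
qed

lemma vec_has_derivative_pd:
  fixes F :: "real^'n \<Rightarrow> real^'m"
  assumes "\<And>b. (\<lambda>y. F y $ b) differentiable (at x)"
  shows "(F has_derivative (\<lambda>v. \<chi> b. \<Sum>i\<in>UNIV. v $ i * pd i (\<lambda>y. F y $ b) x)) (at x)"
  by (subst has_derivative_componentwise_within)
     (auto simp: Basis_vec_def inner_axis intro!: has_derivative_pd assms)

lemma pd_chain:
  fixes f :: "real^'m \<Rightarrow> real" and F :: "real^'n \<Rightarrow> real^'m"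
  assumes F: "\<And>b. (\<lambda>y. F y $ b) differentiable (at x)" and f: "f differentiable (at (F x))"
  shows "(\<lambda>y. f (F y)) differentiable (at x)"
    and "pd i (\<lambda>y. f (F y)) x = (\<Sum>b\<in>UNIV. pd b f (F x) * pd i (\<lambda>y. F y $ b) x)"
proof -
  have D: "((\<lambda>y. f (F y)) has_derivative
      (\<lambda>v. \<Sum>b\<in>UNIV. (\<chi> b. \<Sum>i\<in>UNIV. v $ i * pd i (\<lambda>y. F y $ b) x) $ b * pd b f (F x))) (at x)"
    using diff_chain_at[OF vec_has_derivative_pd[OF F] has_derivative_pd[OF f]] by (simp add: o_def)
  then show "(\<lambda>y. f (F y)) differentiable (at x)" by (auto simp: differentiable_def)
  show "pd i (\<lambda>y. f (F y)) x = (\<Sum>b\<in>UNIV. pd b f (F x) * pd i (\<lambda>y. F y $ b) x)"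
    unfolding pd_has_derivative[OF D]
    by (simp add: axis_def if_distrib if_distribR mult.commute cong: if_cong)
qed

lemma pd_cong:
  assumes "open S" "x \<in> S" "\<And>y. y \<in> S \<Longrightarrow> f y = g y"
  shows "pd i f x = pd i g x" and "f differentiable (at x) \<longleftrightarrow> g differentiable (at x)"
proof -
  have eq: "(f has_derivative D) (at x) \<longleftrightarrow> (g has_derivative D) (at x)" for D
    using has_derivative_transform_within_open[of f D x UNIV S g]
      has_derivative_transform_within_open[of g D x UNIV S f] assms by auto
  show "pd i f x = pd i g x" unfolding pd_def frechet_derivative_def eq ..
  show "f differentiable (at x) \<longleftrightarrow> g differentiable (at x)" unfolding differentiable_def eq ..
qed

section \<open>Smooth functions\<close>

text \<open>
  Smoothness quantifies over all lists of indices at once. Bounding the length turns it into a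
  condition that can be proved by induction on the order of differentiation, because the derivative
  of a product, quotient or composition is a sum of products of functions known to one order less.
\<close>

primrec differentiable_order :: "nat \<Rightarrow> (real^'n) set \<Rightarrow> (real^'n \<Rightarrow> real) \<Rightarrow> bool" where
  "differentiable_order 0 S f \<longleftrightarrow> (\<forall>x\<in>S. f differentiable (at x))"
| "differentiable_order (Suc k) S f \<longleftrightarrow>
     (\<forall>x\<in>S. f differentiable (at x)) \<and> (\<forall>i. differentiable_order k S (pd i f))"

lemma differentiable_order_iff:
  "differentiable_order k S f \<longleftrightarrow> (\<forall>is. length is \<le> k \<longrightarrow> (\<forall>x\<in>S. foldr pd is f differentiable (at x)))"
proof (induction k arbitrary: f)
  case (Suc k)
  have "(\<forall>is. length is \<le> Suc k \<longrightarrow> Q is) \<longleftrightarrow> Q [] \<and> (\<forall>i is. length is \<le> k \<longrightarrow> Q (is @ [i]))"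
    for Q :: "'a list \<Rightarrow> bool"
    by (metis append_Nil2 length_append_singleton length_0_conv not_less_eq_eq rev_exhaust zero_le list.size(3))
  then show ?case by (simp add: Suc.IH)
qed simp

lemma smooth_on_iff_order: "smooth_on S f \<longleftrightarrow> (\<forall>k. differentiable_order k S f)"
  unfolding smooth_on_def differentiable_order_iff by (meson order_refl)

lemma smooth_onI: "(\<And>k. differentiable_order k S f) \<Longrightarrow> smooth_on S f"
  and smooth_on_order: "smooth_on S f \<Longrightarrow> differentiable_order k S f"
  by (simp_all add: smooth_on_iff_order)

lemma smooth_on_differentiable: "smooth_on S f \<Longrightarrow> x \<in> S \<Longrightarrow> f differentiable (at x)"
  using smooth_on_order[of S f 0] by simp

lemma smooth_on_pd: "smooth_on S f \<Longrightarrow> smooth_on S (pd i f)"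
  by (rule smooth_onI) (use smooth_on_order[of S f "Suc _"] in simp)

lemma smooth_on_subset: "smooth_on S f \<Longrightarrow> T \<subseteq> S \<Longrightarrow> smooth_on T f"
  by (auto simp: smooth_on_def)

text \<open>
  Smoothness is a condition at each point, so that it may be checked in a neighbourhood of each point;
  for tensors on \<open>M\<close> these are the domains on which the immersion has a coordinate representation.
\<close>

lemma smooth_on_local:
  assumes "\<And>x. x \<in> S \<Longrightarrow> \<exists>T. x \<in> T \<and> smooth_on T f"
  shows "smooth_on S f"
  using assms unfolding smooth_on_def by blast

lemma differentiable_order_SucD: "differentiable_order (Suc k) S f \<Longrightarrow> differentiable_order k S f"
  by (simp only: differentiable_order_iff) simp

lemma differentiable_order_cong:
  assumes "open S" "\<And>y. y \<in> S \<Longrightarrow> f y = g y"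
  shows "differentiable_order k S f \<longleftrightarrow> differentiable_order k S g"
  using assms(2)
proof (induction k arbitrary: f g)
  case 0
  then have "f differentiable (at x) \<longleftrightarrow> g differentiable (at x)" if "x \<in> S" for x
    by (intro pd_cong(2)[OF assms(1) that])
  then show ?case by simp
next
  case (Suc k)
  then have 1: "f differentiable (at x) \<longleftrightarrow> g differentiable (at x)" if "x \<in> S" for x
    by (intro pd_cong(2)[OF assms(1) that])
  have "differentiable_order k S (pd i f) = differentiable_order k S (pd i g)" for i
    by (rule Suc.IH) (rule pd_cong(1)[OF assms(1)], use Suc.prems in auto)
  with 1 show ?case by simp
qed

lemma smooth_on_cong:
  assumes "open S" "\<And>y. y \<in> S \<Longrightarrow> f y = g y"
  shows "smooth_on S f \<longleftrightarrow> smooth_on S g"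
  unfolding smooth_on_iff_order using differentiable_order_cong[of S f g] assms by blast

lemma differentiable_order_const: "differentiable_order k S (\<lambda>_. c)"
  by (induction k arbitrary: c) auto

lemma smooth_on_const [simp]: "smooth_on S (\<lambda>_. c)"
  by (rule smooth_onI, rule differentiable_order_const)

lemma differentiable_order_add:
  assumes "open S" "differentiable_order k S f" "differentiable_order k S g"
  shows "differentiable_order k S (\<lambda>x. f x + g x)"
  using assms(2,3)
proof (induction k arbitrary: f g)
  case (Suc k)
  have "differentiable_order k S (pd i (\<lambda>x. f x + g x))" for i
    by (subst differentiable_order_cong[OF \<open>open S\<close>, of _ "\<lambda>x. pd i f x + pd i g x"])
       (use Suc in \<open>auto intro: pd_add\<close>)
  then show ?case using Suc by simp
qed simp

lemma differentiable_order_mult: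
  assumes "open S" "differentiable_order k S f" "differentiable_order k S g"
  shows "differentiable_order k S (\<lambda>x. f x * g x)"
  using assms(2,3)
proof (induction k arbitrary: f g)
  case (Suc k)
  have "differentiable_order k S f" "differentiable_order k S g"
    using Suc.prems differentiable_order_SucD by blast+
  then have 1: "differentiable_order k S (\<lambda>x. pd i f x * g x + f x * pd i g x)" for i
    using Suc.prems by (intro differentiable_order_add[OF \<open>open S\<close>] Suc.IH) simp_all
  have 2: "pd i (\<lambda>x. f x * g x) x = pd i f x * g x + f x * pd i g x" if "x \<in> S" for i x
    using that Suc.prems by (intro pd_mult) simp_all
  have "differentiable_order k S (pd i (\<lambda>x. f x * g x))" for i
    by (rule iffD2[OF differentiable_order_cong[OF \<open>open S\<close>]], erule 2, rule 1)
  then show ?case using Suc.prems by simp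
qed simp

lemma differentiable_order_inverse:
  assumes "open S" "\<And>x. x \<in> S \<Longrightarrow> f x \<noteq> 0" "differentiable_order k S f"
  shows "differentiable_order k S (\<lambda>x. inverse (f x))"
  using assms(3)
proof (induction k)
  case 0
  then show ?case using assms(2) by simp
next
  case (Suc k)
  have d: "pd i (\<lambda>x. inverse (f x)) x = -1 * pd i f x * inverse (f x) * inverse (f x)" if "x \<in> S" for i x
  proof -
    have "((\<lambda>x. inverse (f x)) has_derivative
       (\<lambda>v. - (inverse (f x) * frechet_derivative f (at x) v * inverse (f x)))) (at x)"
      using that Suc.prems assms(2)
      by (intro Deriv.has_derivative_inverse) (auto simp: frechet_derivative_works[symmetric])
    from pd_has_derivative[OF this] show ?thesis by (simp add: pd_def)
  qed
  have "differentiable_order k S (\<lambda>x. inverse (f x))"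
    using Suc differentiable_order_SucD by blast
  then have 1: "differentiable_order k S (\<lambda>x. -1 * pd i f x * inverse (f x) * inverse (f x))" for i
    using Suc.prems
    by (intro differentiable_order_mult[OF \<open>open S\<close>] differentiable_order_const) simp_all
  have "differentiable_order k S (pd i (\<lambda>x. inverse (f x)))" for i
    by (rule iffD2[OF differentiable_order_cong[OF \<open>open S\<close>]], erule d, rule 1)
  then show ?case using Suc.prems assms(2) by simp
qed

lemma smooth_on_add: "open S \<Longrightarrow> smooth_on S f \<Longrightarrow> smooth_on S g \<Longrightarrow> smooth_on S (\<lambda>x. f x + g x)"
  by (rule smooth_onI) (intro differentiable_order_add smooth_on_order)

lemma smooth_on_mult: "open S \<Longrightarrow> smooth_on S f \<Longrightarrow> smooth_on S g \<Longrightarrow> smooth_on S (\<lambda>x. f x * g x)"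
  by (rule smooth_onI) (intro differentiable_order_mult smooth_on_order)

lemma smooth_on_inverse:
  "open S \<Longrightarrow> smooth_on S f \<Longrightarrow> (\<And>x. x \<in> S \<Longrightarrow> f x \<noteq> 0) \<Longrightarrow> smooth_on S (\<lambda>x. inverse (f x))"
  by (rule smooth_onI) (intro differentiable_order_inverse smooth_on_order)

lemma smooth_on_diff:
  assumes "open S" "smooth_on S f" "smooth_on S g" shows "smooth_on S (\<lambda>x. f x - g x)"
  using smooth_on_add[OF assms(1,2) smooth_on_mult[OF assms(1) smooth_on_const[of S "-1"] assms(3)]] by simp

lemma smooth_on_sum:
  assumes "open S" "\<And>a. a \<in> I \<Longrightarrow> smooth_on S (f a)"
  shows "smooth_on S (\<lambda>x. \<Sum>a\<in>I. f a x)"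
  using assms(2) by (induction I rule: infinite_finite_induct) (simp_all add: assms(1) smooth_on_add)

lemma smooth_on_prod:
  assumes "open S" "\<And>a. a \<in> I \<Longrightarrow> smooth_on S (f a)"
  shows "smooth_on S (\<lambda>x. \<Prod>a\<in>I. f a x)"
  using assms(2) by (induction I rule: infinite_finite_induct) (simp_all add: assms(1) smooth_on_mult)

lemma smooth_on_compose:
  fixes f :: "real^'m \<Rightarrow> real" and F :: "real^'n \<Rightarrow> real^'m"
  assumes "open S" "open T" "smooth_on T f" "\<And>b. smooth_on S (\<lambda>y. F y $ b)" "F ` S \<subseteq> T"
  shows "smooth_on S (\<lambda>x. f (F x))"
proof (rule smooth_onI)
  fix k
  have *: "differentiable_order k S (\<lambda>x. f (F x))" if "differentiable_order k T f" for f
    using that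
  proof (induction k arbitrary: f)
    case 0
    then have "(\<lambda>y. f (F y)) differentiable (at x)" if "x \<in> S" for x
      using that assms(4,5) by (intro pd_chain(1)[of F x f]) (auto intro: smooth_on_differentiable)
    then show ?case by simp
  next
    case (Suc k)
    have d: "(\<lambda>y. f (F y)) differentiable (at x)" if "x \<in> S" for x
      using that Suc.prems assms(4,5)
      by (intro pd_chain(1)[of F x f]) (auto intro: smooth_on_differentiable)
    have pd: "pd i (\<lambda>y. f (F y)) x = (\<Sum>b\<in>UNIV. pd b f (F x) * pd i (\<lambda>y. F y $ b) x)"
      if "x \<in> S" for i x
      using that Suc.prems assms(4,5)
      by (intro pd_chain(2)[of F x f]) (auto intro: smooth_on_differentiable)
    have sum: "differentiable_order k S (\<lambda>x. \<Sum>a\<in>I. g a x)"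
      if "\<And>a. differentiable_order k S (g a)" for g :: "'m \<Rightarrow> real^'n \<Rightarrow> real" and I
      using that by (induction I rule: infinite_finite_induct)
        (simp_all add: differentiable_order_const differentiable_order_add[OF \<open>open S\<close>])
    have "differentiable_order k S (\<lambda>x. pd b f (F x))" for b
      using Suc by simp
    then have 1: "differentiable_order k S (\<lambda>x. \<Sum>b\<in>UNIV. pd b f (F x) * pd i (\<lambda>y. F y $ b) x)" for i
      using assms(4) by (intro sum differentiable_order_mult[OF \<open>open S\<close>]) (auto intro: smooth_on_order smooth_on_pd)
    have "differentiable_order k S (pd i (\<lambda>y. f (F y)))" for i
      by (rule iffD2[OF differentiable_order_cong[OF \<open>open S\<close>]], erule pd, rule 1)
    with d show ?case by simp
  qed
  show "differentiable_order k S (\<lambda>x. f (F x))" using * assms(3) smooth_on_order by blast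
qed

lemma smooth_on_det:
  fixes B :: "real^'n \<Rightarrow> real^'m^'m"
  assumes "open S" "\<And>i j. smooth_on S (\<lambda>x. B x $ i $ j)"
  shows "smooth_on S (\<lambda>x. det (B x))"
  unfolding det_def using assms by (intro smooth_on_sum smooth_on_mult smooth_on_prod smooth_on_const) auto

lemma matrix_inv_inverse:
  assumes "invertible A"
  shows "A ** matrix_inv A = mat 1" and "matrix_inv A ** A = mat 1"
  using someI_ex[OF assms[unfolded invertible_def]] unfolding matrix_inv_def by blast+

text \<open>
  Cramer's rule makes the entries of the inverse rational functions of the entries of \<open>A\<close>, whence they
  depend smoothly on a point whenever the entries of \<open>A\<close> do.
\<close>

lemma matrix_inv_entry:
  fixes A :: "real^'n^'n"
  assumes "invertible A"
  shows "matrix_inv A $ p $ q = det (\<chi> i j. if j = p then axis q 1 $ i else A $ i $ j) * inverse (det A)"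
proof -
  have "A *v (matrix_inv A *v axis q 1) = axis q 1"
    using assms by (simp add: matrix_vector_mul_assoc matrix_inv_inverse)
  then have "matrix_inv A *v axis q 1 =
      (\<chi> k. det (\<chi> i j. if j = k then axis q 1 $ i else A $ i $ j) / det A)"
    using cramer[of A] assms by (simp add: invertible_det_nz)
  then have "(matrix_inv A *v axis q 1) $ p = det (\<chi> i j. if j = p then axis q 1 $ i else A $ i $ j) / det A"
    by simp
  then show ?thesis by (simp add: matrix_vector_mult_basis column_def divide_inverse)
qed

lemma smooth_on_matrix_inv:
  fixes B :: "real^'n \<Rightarrow> real^'m^'m"
  assumes "open S" "\<And>i j. smooth_on S (\<lambda>x. B x $ i $ j)" "\<And>x. x \<in> S \<Longrightarrow> invertible (B x)"
  shows "smooth_on S (\<lambda>x. matrix_inv (B x) $ p $ q)"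
proof -
  have "smooth_on S (\<lambda>x. if j = p then axis q 1 $ i else B x $ i $ j)" for i j
    using assms(2) by (cases "j = p") auto
  then have *: "smooth_on S (\<lambda>x. det (\<chi> i j. if j = p then axis q 1 $ i else B x $ i $ j) * inverse (det (B x)))"
    using assms
    by (intro smooth_on_mult smooth_on_inverse smooth_on_det)
       (simp_all add: invertible_det_nz)
  show ?thesis
    by (subst smooth_on_cong[OF assms(1) matrix_inv_entry[OF assms(3)]]) (use * in auto)
qed

section \<open>Mixed partial derivatives commute\<close>

text \<open>
  The mean value theorem in the direction \<open>i\<close> and then in the direction \<open>j\<close>. The second difference on
  the left is symmetric in \<open>i\<close> and \<open>j\<close>, which is why mixed derivatives commute.
\<close>

lemma mixed_difference_mean_value:
  fixes f :: "real^'n \<Rightarrow> real"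
  and i j :: 'n
  defines "u \<equiv> axis i 1 :: real^'n" and "v \<equiv> axis j 1 :: real^'n"
  assumes "smooth_on (ball x \<delta>) f" "0 < s" "2 * s < \<delta>"
  shows "\<exists>y\<in>ball x \<delta>. f (x + s *\<^sub>R u + s *\<^sub>R v) - f (x + s *\<^sub>R u) - f (x + s *\<^sub>R v) + f x = s * s * pd j (pd i f) y"
proof -
  have inb: "x + a *\<^sub>R u + b *\<^sub>R v \<in> ball x \<delta>" if "0 \<le> a" "a \<le> s" "0 \<le> b" "b \<le> s" for a b
  proof -
    have "norm (a *\<^sub>R u + b *\<^sub>R v) \<le> a + b"
      using norm_triangle_ineq[of "a *\<^sub>R u" "b *\<^sub>R v"] that by (simp add: u_def v_def)
    moreover have "x - (x + a *\<^sub>R u + b *\<^sub>R v) = - (a *\<^sub>R u + b *\<^sub>R v)" by simp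
    ultimately show ?thesis using assms(5) that unfolding mem_ball dist_norm by (simp only: norm_minus_cancel)
  qed
  have der: "((\<lambda>t. g (w + t *\<^sub>R axis k 1)) has_real_derivative pd k g (w + t *\<^sub>R axis k 1)) (at t)"
    if "smooth_on (ball x \<delta>) g" "w + t *\<^sub>R axis k 1 \<in> ball x \<delta>" for g :: "real^'n \<Rightarrow> real" and w t k
  proof -
    have 1: "((\<lambda>t. w + t *\<^sub>R axis k 1) has_derivative (\<lambda>t. t *\<^sub>R axis k (1::real))) (at t)"
      by (auto intro!: derivative_eq_intros)
    have 2: "(g has_derivative (\<lambda>v. \<Sum>i\<in>UNIV. v $ i * pd i g (w + t *\<^sub>R axis k 1))) (at (w + t *\<^sub>R axis k 1))"
      using that by (intro has_derivative_pd) (rule smooth_on_differentiable)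
    have "(\<lambda>r. \<Sum>i\<in>UNIV. (r *\<^sub>R axis k 1) $ i * pd i g (w + t *\<^sub>R axis k 1)) = (*) (pd k g (w + t *\<^sub>R axis k 1))"
      by (rule ext) (simp add: axis_def if_distrib if_distribR mult.commute cong: if_cong)
    with diff_chain_at[OF 1 2] show ?thesis by (simp add: has_field_derivative_def o_def)
  qed
  let ?\<phi> = "\<lambda>t. f (x + s *\<^sub>R v + t *\<^sub>R u) - f (x + t *\<^sub>R u)"
  have "\<exists>z. 0 < z \<and> z < s \<and> ?\<phi> s - ?\<phi> 0 = (s - 0) * (pd i f (x + s *\<^sub>R v + z *\<^sub>R u) - pd i f (x + z *\<^sub>R u))"
  proof (rule MVT2[OF \<open>0 < s\<close>])
    fix t assume "0 \<le> t" "t \<le> s"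
    then show "(?\<phi> has_real_derivative pd i f (x + s *\<^sub>R v + t *\<^sub>R u) - pd i f (x + t *\<^sub>R u)) (at t)"
      using DERIV_diff[OF der[of f "x + s *\<^sub>R v" t i] der[of f x t i]] inb[of t s] inb[of t 0] assms(3,4)
      by (simp add: u_def[symmetric] add.assoc add.commute[of "s *\<^sub>R v"])
  qed
  then obtain a where a: "0 < a" "a < s"
    "?\<phi> s - ?\<phi> 0 = s * (pd i f (x + s *\<^sub>R v + a *\<^sub>R u) - pd i f (x + a *\<^sub>R u))" by auto
  have "\<exists>z. 0 < z \<and> z < s \<and> pd i f (x + a *\<^sub>R u + s *\<^sub>R v) - pd i f (x + a *\<^sub>R u + 0 *\<^sub>R v) =
      (s - 0) * pd j (pd i f) (x + a *\<^sub>R u + z *\<^sub>R v)"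
  proof (rule MVT2[OF \<open>0 < s\<close>])
    fix t assume "0 \<le> t" "t \<le> s"
    then show "((\<lambda>t. pd i f (x + a *\<^sub>R u + t *\<^sub>R v)) has_real_derivative
        pd j (pd i f) (x + a *\<^sub>R u + t *\<^sub>R v)) (at t)"
      using der[of "pd i f" "x + a *\<^sub>R u" t j] inb[of a t] a smooth_on_pd[OF assms(3)]
      by (simp add: v_def[symmetric])
  qed
  then obtain b where b: "0 < b" "b < s"
    "pd i f (x + a *\<^sub>R u + s *\<^sub>R v) - pd i f (x + a *\<^sub>R u) = s * pd j (pd i f) (x + a *\<^sub>R u + b *\<^sub>R v)" by auto
  have "f (x + s *\<^sub>R u + s *\<^sub>R v) - f (x + s *\<^sub>R u) - f (x + s *\<^sub>R v) + f x =
      s * s * pd j (pd i f) (x + a *\<^sub>R u + b *\<^sub>R v)"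
    using a(3) b(3) by (simp add: ac_simps)
  then show ?thesis using inb[of a b] a b by (intro bexI) auto
qed

lemma pd_commute:
  fixes f :: "real^'n \<Rightarrow> real"
  assumes "open S" "x \<in> S" "smooth_on S f"
  shows "pd i (pd j f) x = pd j (pd i f) x"
proof (rule ccontr)
  assume ne: "pd i (pd j f) x \<noteq> pd j (pd i f) x"
  define \<eta> where "\<eta> = \<bar>pd i (pd j f) x - pd j (pd i f) x\<bar> / 2"
  have "\<eta> > 0" using ne by (simp add: \<eta>_def)
  have cont: "\<exists>\<delta>>0. \<forall>y\<in>ball x \<delta>. \<bar>pd k (pd l f) y - pd k (pd l f) x\<bar> < \<eta>" for k l
  proof -
    have "continuous (at x) (pd k (pd l f))"
      using assms by (intro differentiable_imp_continuous_within smooth_on_differentiable[of S] smooth_on_pd)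
    then obtain \<delta> where "\<delta> > 0" "\<And>y. dist y x < \<delta> \<Longrightarrow> dist (pd k (pd l f) y) (pd k (pd l f) x) < \<eta>"
      unfolding continuous_at_eps_delta using \<open>\<eta> > 0\<close> by blast
    then show ?thesis by (intro exI[of _ \<delta>]) (simp add: dist_real_def dist_commute)
  qed
  obtain d1 where d1: "d1 > 0" "\<And>y. y \<in> ball x d1 \<Longrightarrow> \<bar>pd i (pd j f) y - pd i (pd j f) x\<bar> < \<eta>"
    using cont by blast
  obtain d2 where d2: "d2 > 0" "\<And>y. y \<in> ball x d2 \<Longrightarrow> \<bar>pd j (pd i f) y - pd j (pd i f) x\<bar> < \<eta>"
    using cont by blast
  obtain d3 where d3: "d3 > 0" "ball x d3 \<subseteq> S" using assms open_contains_ball by blast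
  \<comment> \<open>on this ball both mixed derivatives are within half their supposed difference of their values at \<open>x\<close>\<close>
  define \<delta> where "\<delta> = min d1 (min d2 d3)"
  have \<delta>: "\<delta> > 0" "ball x \<delta> \<subseteq> ball x d1" "ball x \<delta> \<subseteq> ball x d2" "ball x \<delta> \<subseteq> S"
    using d1 d2 d3 by (auto simp: \<delta>_def)
  define s where "s = \<delta> / 3"
  have s: "0 < s" "2 * s < \<delta>" using \<delta>(1) by (auto simp: s_def)
  have sm: "smooth_on (ball x \<delta>) f" using assms(3) \<delta>(4) by (rule smooth_on_subset)
  obtain y where y: "y \<in> ball x \<delta>" "f (x + s *\<^sub>R axis i 1 + s *\<^sub>R axis j 1) - f (x + s *\<^sub>R axis i 1)
      - f (x + s *\<^sub>R axis j 1) + f x = s * s * pd j (pd i f) y"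
    using mixed_difference_mean_value[OF sm s, of i j] by blast
  obtain z where z: "z \<in> ball x \<delta>" "f (x + s *\<^sub>R axis j 1 + s *\<^sub>R axis i 1) - f (x + s *\<^sub>R axis j 1)
      - f (x + s *\<^sub>R axis i 1) + f x = s * s * pd i (pd j f) z"
    using mixed_difference_mean_value[OF sm s, of j i] by blast
  have "s * s * pd j (pd i f) y = s * s * pd i (pd j f) z"
    unfolding y(2)[symmetric] z(2)[symmetric] by (simp add: ac_simps)
  then have "pd j (pd i f) y = pd i (pd j f) z" using s by simp
  moreover have "\<bar>pd j (pd i f) y - pd j (pd i f) x\<bar> < \<eta>" using y(1) \<delta>(3) d2(2) by blast
  moreover have "\<bar>pd i (pd j f) z - pd i (pd j f) x\<bar> < \<eta>" using z(1) \<delta>(2) d1(2) by blast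
  moreover have "\<bar>pd i (pd j f) x - pd j (pd i f) x\<bar> = 2 * \<eta>" by (simp add: \<eta>_def)
  ultimately show False by linarith
qed

section \<open>Directional derivatives\<close>

definition dir_deriv :: "real^'n \<Rightarrow> (real^'n \<Rightarrow> real) \<Rightarrow> real^'n \<Rightarrow> real" where
  "dir_deriv X f x = (\<Sum>b\<in>UNIV. X $ b * pd b f x)"

definition dir_deriv_vec :: "real^'n \<Rightarrow> (real^'n \<Rightarrow> real^'k) \<Rightarrow> real^'n \<Rightarrow> real^'k" where
  "dir_deriv_vec X V x = (\<chi> a. dir_deriv X (\<lambda>y. V y $ a) x)"

definition dir_deriv_mat :: "(real^'n \<Rightarrow> real^'k^'l) \<Rightarrow> real^'n \<Rightarrow> real^'n \<Rightarrow> real^'k^'l" where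
  "dir_deriv_mat T x X = (\<chi> i j. dir_deriv X (\<lambda>y. T y $ i $ j) x)"

definition vec_differentiable :: "(real^'n \<Rightarrow> real^'k) \<Rightarrow> real^'n \<Rightarrow> bool" where
  "vec_differentiable V x \<longleftrightarrow> (\<forall>a. (\<lambda>y. V y $ a) differentiable (at x))"

definition mat_differentiable :: "(real^'n \<Rightarrow> real^'k^'l) \<Rightarrow> real^'n \<Rightarrow> bool" where
  "mat_differentiable T x \<longleftrightarrow> (\<forall>i j. (\<lambda>y. T y $ i $ j) differentiable (at x))"

lemma sum_axis [simp]:
  fixes f :: "'n::finite \<Rightarrow> real"
  shows "(\<Sum>b\<in>UNIV. axis i 1 $ b * f b) = f i" and "(\<Sum>b\<in>UNIV. f b * axis i 1 $ b) = f i"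
  by (simp_all add: axis_def if_distrib if_distribR cong: if_cong)

lemma dir_deriv_axis: "dir_deriv (axis i 1) f x = pd i f x"
  by (simp add: dir_deriv_def)

lemma dir_deriv_mult:
  assumes "f differentiable (at x)" "g differentiable (at x)"
  shows "dir_deriv X (\<lambda>y. f y * g y) x = dir_deriv X f x * g x + f x * dir_deriv X g x"
  by (simp add: dir_deriv_def pd_mult assms algebra_simps sum.distrib sum_distrib_left)

lemma dir_deriv_sum:
  assumes "\<And>a. a \<in> I \<Longrightarrow> f a differentiable (at x)"
  shows "dir_deriv X (\<lambda>y. \<Sum>a\<in>I. f a y) x = (\<Sum>a\<in>I. dir_deriv X (f a) x)"
  unfolding dir_deriv_def by (simp add: pd_sum assms sum_distrib_left) (rule sum.swap)

lemma dir_deriv_const [simp]: "dir_deriv X (\<lambda>_. c) x = 0"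
  by (simp add: dir_deriv_def)

lemma dir_deriv_minus: "f differentiable (at x) \<Longrightarrow> dir_deriv X (\<lambda>y. - f y) x = - dir_deriv X f x"
  by (simp add: dir_deriv_def pd_minus sum_negf)

lemma dir_deriv_cong:
  assumes "open S" "x \<in> S" "\<And>y. y \<in> S \<Longrightarrow> f y = g y"
  shows "dir_deriv X f x = dir_deriv X g x"
  using pd_cong(1)[OF assms] by (simp add: dir_deriv_def)

lemma dir_deriv_linear: "dir_deriv (X + Y) f x = dir_deriv X f x + dir_deriv Y f x" "dir_deriv (c *\<^sub>R X) f x = c * dir_deriv X f x"
  by (simp_all add: dir_deriv_def algebra_simps sum.distrib sum_distrib_left)

lemma dir_deriv_mat_linear: "dir_deriv_mat T x (X + Y) = dir_deriv_mat T x X + dir_deriv_mat T x Y"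
    "dir_deriv_mat T x (c *\<^sub>R X) = c *\<^sub>R dir_deriv_mat T x X"
  by (simp_all add: dir_deriv_mat_def vec_eq_iff dir_deriv_linear)

lemma dir_deriv_vec_const [simp]: "dir_deriv_vec X (\<lambda>_. c) x = 0"
  by (simp add: dir_deriv_vec_def vec_eq_iff)

lemma vec_differentiable_const [simp]: "vec_differentiable (\<lambda>_. c) x"
  by (simp add: vec_differentiable_def)

lemma differentiable_inner_vec:
  fixes V W :: "real^'n \<Rightarrow> real^'k"
  assumes "vec_differentiable V x" "vec_differentiable W x"
  shows "(\<lambda>y. V y \<bullet> W y) differentiable (at x)"
  using assms by (auto simp: inner_vec_def vec_differentiable_def intro!: differentiable_sum differentiable_mult)

lemma dir_deriv_inner:
  assumes "vec_differentiable V x" "vec_differentiable W x"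
  shows "dir_deriv X (\<lambda>y. V y \<bullet> W y) x = dir_deriv_vec X V x \<bullet> W x + V x \<bullet> dir_deriv_vec X W x"
  using assms by (simp add: inner_vec_def vec_differentiable_def dir_deriv_vec_def dir_deriv_sum dir_deriv_mult sum.distrib)

lemma vec_differentiable_matvec:
  assumes "mat_differentiable T x" "vec_differentiable V x"
  shows "vec_differentiable (\<lambda>y. T y *v V y) x"
  using assms by (auto simp: matrix_vector_mult_def mat_differentiable_def vec_differentiable_def intro!: differentiable_sum differentiable_mult)

lemma dir_deriv_vec_matvec:
  assumes "mat_differentiable T x" "vec_differentiable V x"
  shows "dir_deriv_vec X (\<lambda>y. T y *v V y) x = dir_deriv_mat T x X *v V x + T x *v dir_deriv_vec X V x"
  using assms
  by (simp add: matrix_vector_mult_def vec_differentiable_def mat_differentiable_def dir_deriv_vec_def dir_deriv_mat_def vec_eq_iff dir_deriv_sum dir_deriv_mult sum.distrib)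

lemma inner_dir_deriv_mat:
  assumes "mat_differentiable T x"
  shows "V \<bullet> (dir_deriv_mat T x X *v W) = dir_deriv X (\<lambda>y. V \<bullet> (T y *v W)) x"
  by (simp add: dir_deriv_inner vec_differentiable_matvec dir_deriv_vec_matvec assms)

text \<open>
  Applied successively to each argument, this reduces an identity between multilinear functions to its
  components.
\<close>

lemma linear_eq_axis:
  fixes f g :: "real^'n \<Rightarrow> 'v::real_vector"
  assumes "linear f" "linear g" "\<And>i. f (axis i 1) = g (axis i 1)"
  shows "f x = g x"
proof -
  have "f x = g x" if "x = (\<Sum>i\<in>UNIV. x $ i *\<^sub>R axis i 1)"
    by (subst (1 2) that) (simp add: linear_sum assms linear_cmul)
  then show ?thesis using basis_expansion[of x] by (simp add: scalar_mult_eq_scaleR)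
qed

lemma axis_inner_matvec: "axis i 1 \<bullet> (M *v axis j 1) = (M::real^'n^'m) $ i $ j"
  by (simp add: matrix_vector_mult_basis column_def inner_axis')

section \<open>Christoffel symbols\<close>

text \<open>
  The bilinear map \<open>\<Gamma>(X, Y)\<close>, so that the covariant derivative of a vector field \<open>Y\<close> in the direction \<open>X\<close>
  is the directional derivative of \<open>Y\<close> plus \<open>\<Gamma>(X, Y)\<close>.
\<close>

definition christoffel_vec :: "(real^'n \<Rightarrow> real^'n^'n) \<Rightarrow> real^'n \<Rightarrow> real^'n \<Rightarrow> real^'n \<Rightarrow> real^'n" where
  "christoffel_vec g x X Y = (\<chi> a. \<Sum>b\<in>UNIV. \<Sum>e\<in>UNIV. christoffel g x a b e * X $ b * Y $ e)"

lemma christoffel_vec_linear: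
  "christoffel_vec g x (X + X') Y = christoffel_vec g x X Y + christoffel_vec g x X' Y"
    "christoffel_vec g x (c *\<^sub>R X) Y = c *\<^sub>R christoffel_vec g x X Y"
  "christoffel_vec g x X (Y + Y') = christoffel_vec g x X Y + christoffel_vec g x X Y'"
    "christoffel_vec g x X (c *\<^sub>R Y) = c *\<^sub>R christoffel_vec g x X Y"
  by (simp_all add: christoffel_vec_def vec_eq_iff algebra_simps sum.distrib sum_distrib_left)

lemma christoffel_vec_axis: "christoffel_vec g x (axis i 1) (axis j 1) $ p = christoffel g x p i j"
  by (simp add: christoffel_vec_def)

lemmas multilinear_simps = dir_deriv_mat_linear christoffel_vec_linear inner_simps matrix_vector_right_distrib
  matrix_vector_mult_add_rdistrib matrix_vector_mult_scaleR scaleR_matrix_vector_assoc[symmetric]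

locale metric_domain =
  fixes S :: "(real^'n) set" and g :: "real^'n \<Rightarrow> real^'n^'n"
  assumes open_S: "open S"
    and smooth_metric: "smooth_on S (\<lambda>x. g x $ i $ j)"
    and metric_sym: "x \<in> S \<Longrightarrow> transpose (g x) = g x"
    and metric_inv: "x \<in> S \<Longrightarrow> invertible (g x)"
begin

lemma metric_entry_sym: "x \<in> S \<Longrightarrow> g x $ i $ j = g x $ j $ i"
  using metric_sym[of x] by (metis transpose_def vec_lambda_beta)

lemma metric_inner_sym: "x \<in> S \<Longrightarrow> X \<bullet> (g x *v Y) = Y \<bullet> (g x *v X)"
  by (metis metric_sym dot_lmul_matrix inner_commute vector_transpose_matrix)

lemma metric_mat_differentiable: "x \<in> S \<Longrightarrow> mat_differentiable g x"
  using smooth_metric smooth_on_differentiable by (fastforce simp: mat_differentiable_def)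

lemma smooth_on_christoffel: "smooth_on S (\<lambda>x. christoffel g x p i j)"
  unfolding christoffel_def
  by (intro smooth_on_mult smooth_on_sum smooth_on_diff smooth_on_add smooth_on_pd smooth_metric open_S
      smooth_on_matrix_inv metric_inv smooth_on_const)

lemma pd_metric_sym: "x \<in> S \<Longrightarrow> pd l (\<lambda>y. g y $ a $ b) x = pd l (\<lambda>y. g y $ b $ a) x"
  by (rule pd_cong(1)[OF open_S]) (simp_all add: metric_entry_sym)

lemma christoffel_sym: "x \<in> S \<Longrightarrow> christoffel g x p i j = christoffel g x p j i"
  unfolding christoffel_def by (simp add: pd_metric_sym[of x _ i j] algebra_simps)

lemma christoffel_vec_sym: "x \<in> S \<Longrightarrow> christoffel_vec g x X Y = christoffel_vec g x Y X"
  unfolding christoffel_vec_def vec_eq_iff vec_lambda_beta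
  by (intro allI, subst sum.swap) (simp add: christoffel_sym[of x] mult.assoc mult.commute[of "X $ _"])

lemma christoffel_lowered:
  assumes "x \<in> S"
  shows "(\<Sum>p\<in>UNIV. christoffel g x p i j * g x $ p $ k) =
    (1/2) * (pd i (\<lambda>y. g y $ j $ k) x + pd j (\<lambda>y. g y $ i $ k) x - pd k (\<lambda>y. g y $ i $ j) x)"
proof -
  define E where "E q = pd i (\<lambda>y. g y $ j $ q) x + pd j (\<lambda>y. g y $ i $ q) x - pd q (\<lambda>y. g y $ i $ j) x" for q
  have "(\<Sum>p\<in>UNIV. matrix_inv (g x) $ p $ q * g x $ p $ k) = (mat 1 :: real^'n^'n) $ k $ q" for q
  proof -
    have "(\<Sum>p\<in>UNIV. matrix_inv (g x) $ p $ q * g x $ p $ k) = (g x ** matrix_inv (g x)) $ k $ q"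
      by (simp add: matrix_matrix_mult_def metric_entry_sym[OF assms, of _ k] mult.commute)
    then show ?thesis by (simp add: matrix_inv_inverse metric_inv assms)
  qed
  then have inv: "(\<Sum>p\<in>UNIV. matrix_inv (g x) $ p $ q * g x $ p $ k) = (if k = q then 1 else 0)" for q
    by (simp add: mat_def)
  have "(\<Sum>p\<in>UNIV. christoffel g x p i j * g x $ p $ k) =
      (\<Sum>p\<in>UNIV. \<Sum>q\<in>UNIV. (1/2) * E q * (matrix_inv (g x) $ p $ q * g x $ p $ k))"
    unfolding christoffel_def E_def[symmetric] sum_distrib_left sum_distrib_right
    by (intro sum.cong refl) (simp add: algebra_simps)
  also have "\<dots> = (\<Sum>q\<in>UNIV. (1/2) * E q * (\<Sum>p\<in>UNIV. matrix_inv (g x) $ p $ q * g x $ p $ k))"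
    by (subst sum.swap) (simp add: sum_distrib_left)
  also have "\<dots> = (1/2) * E k"
    by (simp add: inv if_distrib cong: if_cong)
  finally show ?thesis unfolding E_def .
qed

text \<open>
  Compatibility of the connection with the metric: adding two lowered Christoffel symbols cancels all but one
  of the derivatives of the metric.
\<close>

lemma pd_metric:
  assumes "x \<in> S"
  shows "pd i (\<lambda>y. g y $ j $ k) x =
    (\<Sum>p\<in>UNIV. christoffel g x p i j * g x $ p $ k) + (\<Sum>p\<in>UNIV. christoffel g x p i k * g x $ p $ j)"
proof -
  show ?thesis
    unfolding christoffel_lowered[OF assms] using pd_metric_sym[OF assms, of i k j]
    by (simp add: field_simps)
qed

text \<open>
  Vanishing of the covariant derivative of a covariant 2-tensor. All pairings are of the form
  \<open>V \<bullet> (T *v W)\<close>, which covers both the metric and the two-form.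
\<close>

definition parallel_on :: "(real^'n \<Rightarrow> real^'n^'n) \<Rightarrow> bool" where
  "parallel_on T \<longleftrightarrow> (\<forall>x\<in>S. \<forall>X V W.
     V \<bullet> (dir_deriv_mat T x X *v W) = christoffel_vec g x X V \<bullet> (T x *v W) + V \<bullet> (T x *v christoffel_vec g x X W))"

lemma metric_parallel: "parallel_on g"
  unfolding parallel_on_def
proof (intro ballI allI)
  fix x X V W assume x: "x \<in> S"
  let ?L = "\<lambda>X V W. V \<bullet> (dir_deriv_mat g x X *v W)"
  let ?R = "\<lambda>X V W. christoffel_vec g x X V \<bullet> (g x *v W) + V \<bullet> (g x *v christoffel_vec g x X W)"
  note lin = multilinear_simps
  have basis: "?L (axis i 1) (axis j 1) (axis k 1) = ?R (axis i 1) (axis j 1) (axis k 1)" for i j k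
  proof -
    have 1: "christoffel_vec g x (axis i 1) (axis a 1) \<bullet> (g x *v axis b 1) = (\<Sum>p\<in>UNIV. christoffel g x p i a * g x $ p $ b)" for a b
      by (simp add: inner_vec_def christoffel_vec_axis matrix_vector_mult_basis column_def)
    show ?thesis
      unfolding axis_inner_matvec metric_inner_sym[OF x, of "axis j 1"] 1
      by (simp add: dir_deriv_mat_def dir_deriv_axis pd_metric[OF x])
  qed
  have 2: "?L (axis i 1) (axis j 1) W = ?R (axis i 1) (axis j 1) W" for i j
    by (rule linear_eq_axis[of "\<lambda>W. ?L (axis i 1) (axis j 1) W"])
       ((rule linearI; simp add: lin algebra_simps), (rule linearI; simp add: lin algebra_simps), rule basis)
  have 3: "?L (axis i 1) V W = ?R (axis i 1) V W" for i
    by (rule linear_eq_axis[of "\<lambda>V. ?L (axis i 1) V W"])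
       ((rule linearI; simp add: lin algebra_simps), (rule linearI; simp add: lin algebra_simps), rule 2)
  show "?L X V W = ?R X V W"
    by (rule linear_eq_axis[of "\<lambda>X. ?L X V W"])
       ((rule linearI; simp add: lin algebra_simps), (rule linearI; simp add: lin algebra_simps), rule 3)
qed

end

section \<open>Curvature\<close>

definition christoffel_vec_deriv :: "(real^'n \<Rightarrow> real^'n^'n) \<Rightarrow> real^'n \<Rightarrow> real^'n \<Rightarrow> real^'n \<Rightarrow> real^'n \<Rightarrow> real^'n" where
  "christoffel_vec_deriv g x X Y Z = (\<chi> a. \<Sum>b\<in>UNIV. \<Sum>e\<in>UNIV. dir_deriv X (\<lambda>y. christoffel g y a b e) x * Y $ b * Z $ e)"

text \<open>
  The curvature operator \<open>R(X, Y) Z\<close>, in the convention of \<open>curv\<close>.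
\<close>

definition curv_vec :: "(real^'n \<Rightarrow> real^'n^'n) \<Rightarrow> real^'n \<Rightarrow> real^'n \<Rightarrow> real^'n \<Rightarrow> real^'n \<Rightarrow> real^'n" where
  "curv_vec g x X Y Z = christoffel_vec_deriv g x X Y Z - christoffel_vec_deriv g x Y X Z + christoffel_vec g x X (christoffel_vec g x Y Z) - christoffel_vec g x Y (christoffel_vec g x X Z)"

lemma christoffel_vec_deriv_linear:
  "christoffel_vec_deriv g x (X + X') Y Z = christoffel_vec_deriv g x X Y Z + christoffel_vec_deriv g x X' Y Z"
    "christoffel_vec_deriv g x (c *\<^sub>R X) Y Z = c *\<^sub>R christoffel_vec_deriv g x X Y Z"
  "christoffel_vec_deriv g x X (Y + Y') Z = christoffel_vec_deriv g x X Y Z + christoffel_vec_deriv g x X Y' Z"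
    "christoffel_vec_deriv g x X (c *\<^sub>R Y) Z = c *\<^sub>R christoffel_vec_deriv g x X Y Z"
  "christoffel_vec_deriv g x X Y (Z + Z') = christoffel_vec_deriv g x X Y Z + christoffel_vec_deriv g x X Y Z'"
    "christoffel_vec_deriv g x X Y (c *\<^sub>R Z) = c *\<^sub>R christoffel_vec_deriv g x X Y Z"
  by (simp_all add: christoffel_vec_deriv_def dir_deriv_linear vec_eq_iff algebra_simps sum.distrib sum_distrib_left)

lemma curv_vec_linear:
  "curv_vec g x (X + X') Y Z = curv_vec g x X Y Z + curv_vec g x X' Y Z" "curv_vec g x (c *\<^sub>R X) Y Z = c *\<^sub>R curv_vec g x X Y Z"
  "curv_vec g x X (Y + Y') Z = curv_vec g x X Y Z + curv_vec g x X Y' Z" "curv_vec g x X (c *\<^sub>R Y) Z = c *\<^sub>R curv_vec g x X Y Z"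
  "curv_vec g x X Y (Z + Z') = curv_vec g x X Y Z + curv_vec g x X Y Z'" "curv_vec g x X Y (c *\<^sub>R Z) = c *\<^sub>R curv_vec g x X Y Z"
  by (simp_all add: curv_vec_def christoffel_vec_deriv_linear christoffel_vec_linear algebra_simps)

lemma curv_vec_axis: "curv_vec g x (axis i 1) (axis j 1) (axis k 1) $ p = curv g x i j k p"
proof -
  have c: "christoffel_vec g x (axis a 1) (christoffel_vec g x (axis b 1) (axis k 1)) $ p =
      (\<Sum>q\<in>UNIV. christoffel g x p a q * christoffel g x q b k)" for a b
  proof -
    have "christoffel_vec g x (axis a 1) V $ p = (\<Sum>q\<in>UNIV. christoffel g x p a q * V $ q)" for V
      unfolding christoffel_vec_def vec_lambda_beta by (subst sum.swap) (simp add: sum_distrib_right[symmetric])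
    then show ?thesis by (simp add: christoffel_vec_axis)
  qed
  have d: "christoffel_vec_deriv g x (axis a 1) (axis b 1) (axis k 1) $ p = pd a (\<lambda>y. christoffel g y p b k) x" for a b
    by (simp add: christoffel_vec_deriv_def dir_deriv_axis)
  show ?thesis by (simp add: curv_vec_def c d curv_def sum_subtractf)
qed

lemma Riem_curv_vec: "Riem g x i j k l = curv_vec g x (axis i 1) (axis j 1) (axis k 1) \<bullet> (g x *v axis l 1)"
  by (simp add: Riem_def inner_vec_def curv_vec_axis matrix_vector_mult_basis column_def)

context metric_domain
begin

text \<open>
  With the last index of the Christoffel symbols lowered before differentiation, the derivatives of the
  metric are absorbed by \<open>pd_metric\<close> and only products of Christoffel symbols remain. In this form the formula
  can be compared with derivatives of \<open>G(\<nabla>\<^sub>j F\<^sub>k, F\<^sub>l)\<close>.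
\<close>

lemma Riem_lowered:
  assumes x: "x \<in> S"
  defines "L i j l y \<equiv> \<Sum>p\<in>UNIV. christoffel g y p i j * g y $ p $ l"
  shows "Riem g x i j k l = pd i (L j k l) x - pd j (L i k l) x
    - (\<Sum>p\<in>UNIV. christoffel g x p j k * L i l p x) + (\<Sum>p\<in>UNIV. christoffel g x p i k * L j l p x)"
proof -
  have pdL: "pd a (L b k l) x = (\<Sum>p\<in>UNIV. pd a (\<lambda>y. christoffel g y p b k) x * g x $ p $ l)
      + (\<Sum>p\<in>UNIV. christoffel g x p b k * L a p l x) + (\<Sum>p\<in>UNIV. christoffel g x p b k * L a l p x)" for a b
  proof -
    have "pd a (L b k l) x = (\<Sum>p\<in>UNIV. pd a (\<lambda>y. christoffel g y p b k) x * g x $ p $ l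
        + christoffel g x p b k * pd a (\<lambda>y. g y $ p $ l) x)"
      unfolding L_def
      by (simp add: pd_sum pd_mult differentiable_mult smooth_on_differentiable[OF smooth_on_christoffel x]
          smooth_on_differentiable[OF smooth_metric x])
    then show ?thesis by (simp add: pd_metric[OF x] L_def algebra_simps sum.distrib)
  qed
  have quad: "(\<Sum>p\<in>UNIV. (\<Sum>q\<in>UNIV. christoffel g x p a q * christoffel g x q b k) * g x $ p $ l) =
      (\<Sum>q\<in>UNIV. christoffel g x q b k * L a q l x)" for a b
    unfolding L_def sum_distrib_right sum_distrib_left
    by (subst sum.swap) (intro sum.cong refl, simp)
  have "Riem g x i j k l =
      (\<Sum>p\<in>UNIV. pd i (\<lambda>y. christoffel g y p j k) x * g x $ p $ l)
    - (\<Sum>p\<in>UNIV. pd j (\<lambda>y. christoffel g y p i k) x * g x $ p $ l)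
    + (\<Sum>p\<in>UNIV. (\<Sum>q\<in>UNIV. christoffel g x p i q * christoffel g x q j k) * g x $ p $ l)
    - (\<Sum>p\<in>UNIV. (\<Sum>q\<in>UNIV. christoffel g x p j q * christoffel g x q i k) * g x $ p $ l)"
    by (simp add: Riem_def curv_def left_diff_distrib distrib_right sum.distrib sum_subtractf)
  then show ?thesis unfolding quad pdL by simp
qed

lemma const_curvature:
  assumes "\<And>i j k l. Riem g x i j k l =
       - C * (metric_square (g x) i j k l + 3 * \<epsilon> * form_square w i j k l)"
  shows "curv_vec g x X Y Z \<bullet> (g x *v W) =
    - C * ((Z \<bullet> (g x *v X)) * (Y \<bullet> (g x *v W)) - (Z \<bullet> (g x *v Y)) * (X \<bullet> (g x *v W))
      + \<epsilon> * ((Z \<bullet> (w *v X)) * (Y \<bullet> (w *v W)) - (Z \<bullet> (w *v Y)) * (X \<bullet> (w *v W))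
        - 2 * (X \<bullet> (w *v Y)) * (Z \<bullet> (w *v W))))"
    (is "?L X Y Z W = ?R X Y Z W")
proof -
  note lin = multilinear_simps curv_vec_linear
  have 1: "?L (axis i 1) (axis j 1) (axis k 1) (axis l 1) = ?R (axis i 1) (axis j 1) (axis k 1) (axis l 1)" for i j k l
    by (simp add: Riem_curv_vec[symmetric] assms axis_inner_matvec metric_square_def form_square_def)
  have 2: "?L (axis i 1) (axis j 1) (axis k 1) W = ?R (axis i 1) (axis j 1) (axis k 1) W" for i j k
    by (rule linear_eq_axis[of "\<lambda>W. ?L (axis i 1) (axis j 1) (axis k 1) W"])
       ((rule linearI; simp add: lin algebra_simps), (rule linearI; simp add: lin algebra_simps), rule 1)
  have 3: "?L (axis i 1) (axis j 1) Z W = ?R (axis i 1) (axis j 1) Z W" for i j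
    by (rule linear_eq_axis[of "\<lambda>Z. ?L (axis i 1) (axis j 1) Z W"])
       ((rule linearI; simp add: lin algebra_simps), (rule linearI; simp add: lin algebra_simps), rule 2)
  have 4: "?L (axis i 1) Y Z W = ?R (axis i 1) Y Z W" for i
    by (rule linear_eq_axis[of "\<lambda>Y. ?L (axis i 1) Y Z W"])
       ((rule linearI; simp add: lin algebra_simps), (rule linearI; simp add: lin algebra_simps), rule 3)
  show ?thesis
    by (rule linear_eq_axis[of "\<lambda>X. ?L X Y Z W"])
       ((rule linearI; simp add: lin algebra_simps), (rule linearI; simp add: lin algebra_simps), rule 4)
qed

end

section \<open>Parallelism of the fundamental form\<close>

text \<open>
  Here \<open>B X Y Z\<close> stands for \<open>(\<nabla>\<^sub>X \<Omega>)(Y, Z)\<close>. Closedness at \<open>(A X, Y, Z)\<close> and at \<open>(A Y, X, Z)\<close> expresses both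
  terms on the left of the integrability condition by values whose first argument does not involve \<open>A\<close>.
  After moving \<open>A\<close> across with \<open>compat\<close>, everything cancels except \<open>- 2 B Z (A X) Y\<close>.
\<close>

lemma closed_integrable_imp_zero:
  fixes B :: "'v \<Rightarrow> 'v \<Rightarrow> 'v \<Rightarrow> real" and A :: "'v \<Rightarrow> 'v"
  assumes antisym: "\<And>X Y Z. B X Y Z = - B X Z Y"
    and closed: "\<And>X Y Z. B X Y Z + B Y Z X + B Z X Y = 0"
    and compat: "\<And>X Y Z. B X (A Y) Z = B X Y (A Z)"
    and integrable: "\<And>X Y Z. B (A X) Y Z - B (A Y) X Z = B Y X (A Z) - B X Y (A Z)"
    and "surj A"
  shows "B X Y Z = 0"
proof -
  have "B Z (A X) Y = 0" for X Y Z
    using closed[of "A X" Y Z] closed[of "A Y" X Z] integrable[of X Y Z] compat[of Y X Z] compat[of X Y Z]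
      compat[of Z X Y] antisym[of Y Z "A X"] antisym[of X Z "A Y"] antisym[of Z "A Y" X]
      antisym[of Z "A X" Y]
    by linarith
  then show ?thesis using \<open>surj A\<close> by (metis surjD)
qed

locale kaehler_domain = metric_domain S g for S :: "(real^'n) set" and g +
  fixes A \<Omega> :: "real^'n \<Rightarrow> real^'n^'n" and \<epsilon> :: real
  assumes smooth_structure: "smooth_on S (\<lambda>x. A x $ i $ j)"
    and smooth_form: "smooth_on S (\<lambda>x. \<Omega> x $ i $ j)"
    and eps_sq: "\<epsilon> * \<epsilon> = 1"
    and structure_sq: "x \<in> S \<Longrightarrow> A x ** A x = \<epsilon> *\<^sub>R mat 1"
    and nijenhuis_zero: "x \<in> S \<Longrightarrow> nijenhuis A x k i j = 0"
    and form_antisym: "x \<in> S \<Longrightarrow> transpose (\<Omega> x) = - \<Omega> x"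
    and form_closed: "x \<in> S \<Longrightarrow> pd i (\<lambda>y. \<Omega> y $ j $ k) x + pd j (\<lambda>y. \<Omega> y $ k $ i) x + pd k (\<lambda>y. \<Omega> y $ i $ j) x = 0"
    and form_metric: "x \<in> S \<Longrightarrow> X \<bullet> (\<Omega> x *v Y) = (A x *v X) \<bullet> (g x *v Y)"
begin

lemma structure_mat_differentiable: "x \<in> S \<Longrightarrow> mat_differentiable A x" and form_mat_differentiable: "x \<in> S \<Longrightarrow> mat_differentiable \<Omega> x"
  using smooth_structure smooth_form smooth_on_differentiable by (fastforce simp: mat_differentiable_def)+

lemma structure_twice: "x \<in> S \<Longrightarrow> A x *v (A x *v X) = \<epsilon> *\<^sub>R X"
  by (simp add: matrix_vector_mul_assoc structure_sq scaleR_matrix_vector_assoc[symmetric])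

lemma surj_structure:
  assumes "x \<in> S" shows "surj ((*v) (A x))"
proof (rule surjI)
  show "A x *v (\<epsilon> *\<^sub>R (A x *v X)) = X" for X
    by (simp add: matrix_vector_mult_scaleR structure_twice assms eps_sq)
qed

lemma form_inner_antisym:
  assumes "x \<in> S" shows "X \<bullet> (\<Omega> x *v Y) = - (Y \<bullet> (\<Omega> x *v X))"
proof -
  have "X \<bullet> (\<Omega> x *v Y) = (transpose (\<Omega> x) *v X) \<bullet> Y"
    by (simp add: dot_lmul_matrix[symmetric] vector_transpose_matrix transpose_matrix_vector)
  also have "\<dots> = - (Y \<bullet> (\<Omega> x *v X))"
    by (simp add: form_antisym[OF assms] inner_commute) (metis (no_types) add_eq_0_iff inner_minus_right matrix_vector_mult_add_rdistrib matrix_vector_mult_0 add.right_inverse inner_right_distrib inner_zero_right)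
  finally show ?thesis .
qed

lemma metric_structure: "x \<in> S \<Longrightarrow> X \<bullet> (g x *v (A x *v Y)) = - (X \<bullet> (\<Omega> x *v Y))"
  by (metis form_inner_antisym form_metric metric_inner_sym)

lemma dir_deriv_mat_form:
  assumes x: "x \<in> S"
  shows "V \<bullet> (dir_deriv_mat \<Omega> x X *v W) = (dir_deriv_mat A x X *v V) \<bullet> (g x *v W) + (A x *v V) \<bullet> (dir_deriv_mat g x X *v W)"
proof -
  have "V \<bullet> (dir_deriv_mat \<Omega> x X *v W) = dir_deriv X (\<lambda>y. V \<bullet> (\<Omega> y *v W)) x"
    by (rule inner_dir_deriv_mat[OF form_mat_differentiable[OF x]])
  also have "\<dots> = dir_deriv X (\<lambda>y. (A y *v V) \<bullet> (g y *v W)) x"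
    by (rule dir_deriv_cong[OF open_S x]) (rule form_metric)
  also have "\<dots> = (dir_deriv_mat A x X *v V) \<bullet> (g x *v W) + (A x *v V) \<bullet> (dir_deriv_mat g x X *v W)"
    by (simp add: dir_deriv_inner vec_differentiable_matvec dir_deriv_vec_matvec structure_mat_differentiable metric_mat_differentiable x)
  finally show ?thesis .
qed

lemma dir_deriv_mat_form_antisym:
  assumes x: "x \<in> S"
  shows "V \<bullet> (dir_deriv_mat \<Omega> x X *v W) = - (W \<bullet> (dir_deriv_mat \<Omega> x X *v V))"
proof -
  have "dir_deriv X (\<lambda>y. V \<bullet> (\<Omega> y *v W)) x = dir_deriv X (\<lambda>y. - (W \<bullet> (\<Omega> y *v V))) x"
    by (rule dir_deriv_cong[OF open_S x]) (rule form_inner_antisym)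
  also have "\<dots> = - dir_deriv X (\<lambda>y. W \<bullet> (\<Omega> y *v V)) x"
    by (intro dir_deriv_minus differentiable_inner_vec vec_differentiable_const vec_differentiable_matvec form_mat_differentiable x)
  finally show ?thesis by (simp add: inner_dir_deriv_mat form_mat_differentiable x)
qed

lemma dir_deriv_mat_structure:
  assumes x: "x \<in> S"
  shows "dir_deriv_mat A x X *v (A x *v V) + A x *v (dir_deriv_mat A x X *v V) = 0"
proof -
  have "dir_deriv_vec X (\<lambda>y. A y *v (A y *v V)) x = dir_deriv_vec X (\<lambda>y. \<epsilon> *\<^sub>R V) x"
    unfolding dir_deriv_vec_def vec_eq_iff vec_lambda_beta
    by (intro allI dir_deriv_cong[OF open_S x]) (simp add: structure_twice)
  then show ?thesis by (simp add: dir_deriv_vec_matvec vec_differentiable_matvec structure_mat_differentiable x)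
qed

lemma dir_deriv_mat_form_closed:
  assumes x: "x \<in> S"
  shows "Y \<bullet> (dir_deriv_mat \<Omega> x X *v Z) + Z \<bullet> (dir_deriv_mat \<Omega> x Y *v X) + X \<bullet> (dir_deriv_mat \<Omega> x Z *v Y) = 0" (is "?L X Y Z = 0")
proof -
  note lin = multilinear_simps
  have 1: "?L (axis i 1) (axis j 1) (axis k 1) = 0" for i j k
    using form_closed[OF x, of i j k] by (simp add: axis_inner_matvec dir_deriv_mat_def dir_deriv_axis)
  have 2: "?L (axis i 1) (axis j 1) Z = 0" for i j
    by (rule linear_eq_axis[of "\<lambda>Z. ?L (axis i 1) (axis j 1) Z" "\<lambda>_. 0"])
       ((rule linearI; simp add: lin algebra_simps), rule linear_zero, rule 1)
  have 3: "?L (axis i 1) Y Z = 0" for i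
    by (rule linear_eq_axis[of "\<lambda>Y. ?L (axis i 1) Y Z" "\<lambda>_. 0"])
       ((rule linearI; simp add: lin algebra_simps), rule linear_zero, rule 2)
  show ?thesis
    by (rule linear_eq_axis[of "\<lambda>X. ?L X Y Z" "\<lambda>_. 0"])
       ((rule linearI; simp add: lin algebra_simps), rule linear_zero, rule 3)
qed

text \<open>
  The Nijenhuis tensor is a tensor although its formula contains only partial derivatives of \<open>A\<close>; this is
  its value on arbitrary vectors.
\<close>

lemma dir_deriv_mat_nijenhuis:
  assumes x: "x \<in> S"
  shows "dir_deriv_mat A x (A x *v X) *v Y - dir_deriv_mat A x (A x *v Y) *v X
    + A x *v (dir_deriv_mat A x Y *v X) - A x *v (dir_deriv_mat A x X *v Y) = 0" (is "?L X Y = 0")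
proof -
  note lin = multilinear_simps
  have 1: "?L (axis i 1) (axis j 1) = 0" for i j
  proof -
    have "?L (axis i 1) (axis j 1) $ k = nijenhuis A x k i j" for k
      by (simp add: nijenhuis_def matrix_vector_mult_basis column_def dir_deriv_mat_def dir_deriv_def
          matrix_vector_mult_def[of "A x"] sum.distrib sum_subtractf)
    then show ?thesis using nijenhuis_zero[OF x] by (simp add: vec_eq_iff)
  qed
  have 2: "?L (axis i 1) Y = 0" for i
    by (rule linear_eq_axis[of "\<lambda>Y. ?L (axis i 1) Y" "\<lambda>_. 0"])
       ((rule linearI; simp add: lin algebra_simps), rule linear_zero, rule 1)
  show ?thesis
    by (rule linear_eq_axis[of "\<lambda>X. ?L X Y" "\<lambda>_. 0"])
       ((rule linearI; simp add: lin algebra_simps), rule linear_zero, rule 2)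
qed

text \<open>
  Since \<open>\<Omega>(V, W) = G(A V, W)\<close> and \<open>G\<close> is parallel, \<open>(\<nabla>\<^sub>X \<Omega>)(V, W) = G((\<nabla>\<^sub>X A) V, W)\<close>, and \<open>\<nabla>\<^sub>X A\<close> anticommutes with
  \<open>A\<close> because \<open>A\<^sup>2\<close> is constant. In the exterior derivative and in the Nijenhuis tensor the Christoffel
  symbols cancel by symmetry, so that partial derivatives may be replaced by covariant ones.
\<close>

lemma form_parallel: "parallel_on \<Omega>"
  unfolding parallel_on_def
proof (intro ballI allI)
  fix x X V W assume x: "x \<in> S"
  let ?A = "\<lambda>V. A x *v V" and ?\<Gamma> = "christoffel_vec g x"
  define B where "B X V W = V \<bullet> (dir_deriv_mat \<Omega> x X *v W) - ?\<Gamma> X V \<bullet> (\<Omega> x *v W) - V \<bullet> (\<Omega> x *v ?\<Gamma> X W)" for X V W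
  define D where "D X V = dir_deriv_mat A x X *v V + ?\<Gamma> X (?A V) - ?A (?\<Gamma> X V)" for X V
  \<comment> \<open>\<open>D X V\<close> is \<open>(\<nabla>\<^sub>X A) V\<close>\<close>
  have BD: "B X V W = D X V \<bullet> (g x *v W)" for X V W
    using metric_parallel x
    by (simp add: B_def D_def dir_deriv_mat_form parallel_on_def form_metric inner_simps)
  have DA: "D X (?A V) = - ?A (D X V)" for X V
    using dir_deriv_mat_structure[OF x, of X V]
    by (simp add: D_def matrix_vector_right_distrib matrix_vector_mult_diff_distrib structure_twice x
        christoffel_vec_linear add_eq_0_iff)
  have AD: "D X V \<bullet> (g x *v ?A W) = - (?A (D X V) \<bullet> (g x *v W))" for X V W
    by (simp add: metric_structure form_metric x)
  have N: "D (?A X) Y - D (?A Y) X + ?A (D Y X) - ?A (D X Y) = 0" for X Y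
  proof -
    have "D (?A X) Y - D (?A Y) X + ?A (D Y X) - ?A (D X Y) =
        dir_deriv_mat A x (?A X) *v Y - dir_deriv_mat A x (?A Y) *v X + ?A (dir_deriv_mat A x Y *v X) - ?A (dir_deriv_mat A x X *v Y)"
      by (simp add: D_def matrix_vector_right_distrib matrix_vector_mult_diff_distrib structure_twice x
        christoffel_vec_sym[OF x, of "?A X" "?A Y"] christoffel_vec_sym[OF x, of "?A X" Y] christoffel_vec_sym[OF x, of X "?A Y"]
        christoffel_vec_sym[OF x, of X Y])
    then show ?thesis using dir_deriv_mat_nijenhuis[OF x, of X Y] by simp
  qed
  have "B X V W = 0"
  proof (rule closed_integrable_imp_zero[of B ?A])
    show "B X Y Z = - B X Z Y" for X Y Z
      using dir_deriv_mat_form_antisym[OF x, of Y X Z] form_inner_antisym[OF x, of "?\<Gamma> X Y" Z] form_inner_antisym[OF x, of Y "?\<Gamma> X Z"]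
      unfolding B_def by linarith
    show "B X Y Z + B Y Z X + B Z X Y = 0" for X Y Z
      using dir_deriv_mat_form_closed[OF x, of Y X Z] christoffel_vec_sym[OF x, of X Y] christoffel_vec_sym[OF x, of X Z] christoffel_vec_sym[OF x, of Y Z]
        form_inner_antisym[OF x, of "?\<Gamma> X Y" Z] form_inner_antisym[OF x, of "?\<Gamma> X Z" Y] form_inner_antisym[OF x, of "?\<Gamma> Y Z" X]
      unfolding B_def by simp
    show "B X (?A Y) Z = B X Y (?A Z)" for X Y Z
      by (simp add: BD DA AD)
    show "B (?A X) Y Z - B (?A Y) X Z = B Y X (?A Z) - B X Y (?A Z)" for X Y Z
      using arg_cong[OF N[of X Y], of "\<lambda>U. U \<bullet> (g x *v Z)"] by (simp add: BD AD inner_simps)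
    show "surj ?A" by (rule surj_structure[OF x])
  qed
  then show "V \<bullet> (dir_deriv_mat \<Omega> x X *v W) = ?\<Gamma> X V \<bullet> (\<Omega> x *v W) + V \<bullet> (\<Omega> x *v ?\<Gamma> X W)"
    by (simp add: B_def)
qed

end

section \<open>Vector fields along a map\<close>

lemma smooth_vec_on_vec_differentiable: "smooth_vec_on U V \<Longrightarrow> x \<in> U \<Longrightarrow> vec_differentiable V x"
  by (auto simp: smooth_vec_on_def vec_differentiable_def intro: smooth_on_differentiable)

lemma smooth_vec_on_add:
  "open U \<Longrightarrow> smooth_vec_on U V \<Longrightarrow> smooth_vec_on U W \<Longrightarrow> smooth_vec_on U (\<lambda>x. V x + W x)"
  by (simp add: smooth_vec_on_def smooth_on_add)

lemma smooth_vec_on_dir_deriv_vec: "smooth_vec_on U V \<Longrightarrow> smooth_vec_on U (dir_deriv_vec (axis i 1) V)"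
  by (simp add: smooth_vec_on_def dir_deriv_vec_def dir_deriv_axis smooth_on_pd)

lemma smooth_on_inner:
  "open U \<Longrightarrow> smooth_vec_on U V \<Longrightarrow> smooth_vec_on U W \<Longrightarrow> smooth_on U (\<lambda>x. V x \<bullet> W x)"
  unfolding inner_vec_def inner_real_def smooth_vec_on_def by (intro smooth_on_sum smooth_on_mult) auto

lemma dir_deriv_vec_add: "vec_differentiable V x \<Longrightarrow> vec_differentiable W x \<Longrightarrow> dir_deriv_vec X (\<lambda>y. V y + W y) x = dir_deriv_vec X V x + dir_deriv_vec X W x"
  by (simp add: dir_deriv_vec_def vec_eq_iff vec_differentiable_def dir_deriv_def pd_add algebra_simps sum.distrib)

lemma dir_deriv_vec_commute:
  assumes "open U" "x \<in> U" "smooth_vec_on U V"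
  shows "dir_deriv_vec (axis i 1) (dir_deriv_vec (axis j 1) V) x = dir_deriv_vec (axis j 1) (dir_deriv_vec (axis i 1) V) x"
  using pd_commute[OF assms(1,2)] assms(3) by (simp add: dir_deriv_vec_def vec_eq_iff dir_deriv_axis smooth_vec_on_def)

abbreviation frame :: "(real^'n \<Rightarrow> real^'m) \<Rightarrow> 'n \<Rightarrow> real^'n \<Rightarrow> real^'m" where
  "frame F i \<equiv> dir_deriv_vec (axis i 1) F"

locale map_into_metric_domain = metric_domain S g
  for S :: "(real^'m) set" and g :: "real^'m \<Rightarrow> real^'m^'m" +
  fixes U :: "(real^'n) set" and F :: "real^'n \<Rightarrow> real^'m"
  assumes open_U: "open U" and smooth_F: "smooth_vec_on U F" and F_into: "F ` U \<subseteq> S"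
begin

text \<open>
  The pullback connection in coordinate directions, for fields along \<open>F\<close>.
\<close>

definition cov_along :: "'n \<Rightarrow> (real^'n \<Rightarrow> real^'m) \<Rightarrow> real^'n \<Rightarrow> real^'m" where
  "cov_along i V x = dir_deriv_vec (axis i 1) V x + christoffel_vec g (F x) (frame F i x) (V x)"

lemma F_in: "x \<in> U \<Longrightarrow> F x \<in> S"
  using F_into by auto

lemma smooth_frame: "smooth_vec_on U (frame F i)"
  by (rule smooth_vec_on_dir_deriv_vec[OF smooth_F])

lemma smooth_on_pullback: "smooth_on S f \<Longrightarrow> smooth_on U (\<lambda>x. f (F x))"
  using smooth_on_compose[OF open_U open_S _ _ F_into, of f] smooth_F by (simp add: smooth_vec_on_def)

lemma smooth_vec_on_matvec:
  assumes "\<And>i j. smooth_on S (\<lambda>z. T z $ i $ j)" "smooth_vec_on U V"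
  shows "smooth_vec_on U (\<lambda>x. T (F x) *v V x)"
  using assms(2) smooth_on_pullback[OF assms(1)]
  by (auto simp: smooth_vec_on_def matrix_vector_mult_def intro!: smooth_on_sum smooth_on_mult open_U)

lemma smooth_vec_on_christoffel_vec:
  assumes "smooth_vec_on U V" "smooth_vec_on U W"
  shows "smooth_vec_on U (\<lambda>x. christoffel_vec g (F x) (V x) (W x))"
  using assms smooth_on_pullback[OF smooth_on_christoffel]
  by (auto simp: smooth_vec_on_def christoffel_vec_def intro!: smooth_on_sum smooth_on_mult open_U)

lemma smooth_cov_along: "smooth_vec_on U V \<Longrightarrow> smooth_vec_on U (cov_along i V)"
  unfolding cov_along_def[abs_def] by (intro smooth_vec_on_add open_U smooth_vec_on_christoffel_vec smooth_frame smooth_vec_on_dir_deriv_vec)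

lemma dir_deriv_pullback:
  assumes "smooth_on S f" "x \<in> U"
  shows "dir_deriv (axis i 1) (\<lambda>y. f (F y)) x = dir_deriv (frame F i x) f (F x)"
proof -
  have "pd i (\<lambda>y. f (F y)) x = (\<Sum>b\<in>UNIV. pd b f (F x) * pd i (\<lambda>y. F y $ b) x)"
    using assms F_in smooth_F
    by (intro pd_chain(2)[of F x f]) (auto simp: smooth_vec_on_def intro: smooth_on_differentiable)
  then show ?thesis
    unfolding dir_deriv_def[of "frame F i x"] unfolding dir_deriv_vec_def vec_lambda_beta dir_deriv_axis by (simp add: mult.commute)
qed

text \<open>
  The product rule for a parallel tensor: the chain rule turns the derivative of \<open>T \<circ> F\<close> into the derivative of
  \<open>T\<close> in the direction \<open>F\<^sub>i\<close>, which parallelism expresses by Christoffel symbols.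
\<close>

lemma along_parallel:
  assumes "parallel_on T" and T: "\<And>i j. smooth_on S (\<lambda>z. T z $ i $ j)" and x: "x \<in> U"
    and VW: "smooth_vec_on U V" "smooth_vec_on U W"
  shows "pd i (\<lambda>y. V y \<bullet> (T (F y) *v W y)) x =
    cov_along i V x \<bullet> (T (F x) *v W x) + V x \<bullet> (T (F x) *v cov_along i W x)"
proof -
  note d = smooth_vec_on_vec_differentiable[OF _ x]
  have "mat_differentiable (\<lambda>y. T (F y)) x"
    using smooth_on_differentiable[OF smooth_on_pullback[OF T] x] by (simp add: mat_differentiable_def)
  moreover have "dir_deriv_mat (\<lambda>y. T (F y)) x (axis i 1) = dir_deriv_mat T (F x) (frame F i x)"
    by (simp add: dir_deriv_mat_def vec_eq_iff dir_deriv_pullback[OF T x])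
  ultimately have "pd i (\<lambda>y. V y \<bullet> (T (F y) *v W y)) x =
      dir_deriv_vec (axis i 1) V x \<bullet> (T (F x) *v W x) + V x \<bullet> (dir_deriv_mat T (F x) (frame F i x) *v W x)
      + V x \<bullet> (T (F x) *v dir_deriv_vec (axis i 1) W x)"
    using d[OF VW(1)] d[OF VW(2)]
    by (simp add: dir_deriv_axis[symmetric] dir_deriv_inner vec_differentiable_matvec dir_deriv_vec_matvec inner_simps)
  also have "V x \<bullet> (dir_deriv_mat T (F x) (frame F i x) *v W x) =
      christoffel_vec g (F x) (frame F i x) (V x) \<bullet> (T (F x) *v W x) + V x \<bullet> (T (F x) *v christoffel_vec g (F x) (frame F i x) (W x))"
    using assms(1) F_in[OF x] unfolding parallel_on_def by blast
  finally show ?thesis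
    by (simp add: cov_along_def inner_simps matrix_vector_right_distrib)
qed

lemma torsion_free:
  assumes x: "x \<in> U"
  shows "cov_along i (frame F j) x = cov_along j (frame F i) x"
  by (simp add: cov_along_def dir_deriv_vec_commute[OF open_U x smooth_F, of i j] christoffel_vec_sym[OF F_in[OF x], of "frame F i x"])

lemma dir_deriv_vec_christoffel_vec:
  assumes x: "x \<in> U" and VW: "smooth_vec_on U V" "smooth_vec_on U W"
  shows "dir_deriv_vec (axis i 1) (\<lambda>y. christoffel_vec g (F y) (V y) (W y)) x = christoffel_vec_deriv g (F x) (frame F i x) (V x) (W x)
    + christoffel_vec g (F x) (dir_deriv_vec (axis i 1) V x) (W x) + christoffel_vec g (F x) (V x) (dir_deriv_vec (axis i 1) W x)"
proof -
  have "dir_deriv (axis i 1) (\<lambda>y. christoffel_vec g (F y) (V y) (W y) $ a) x =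
    (\<Sum>b\<in>UNIV. \<Sum>e\<in>UNIV. dir_deriv (frame F i x) (\<lambda>z. christoffel g z a b e) (F x) * V x $ b * W x $ e
      + christoffel g (F x) a b e * dir_deriv_vec (axis i 1) V x $ b * W x $ e
      + christoffel g (F x) a b e * V x $ b * dir_deriv_vec (axis i 1) W x $ e)" for a
    using smooth_vec_on_vec_differentiable[OF VW(1) x] smooth_vec_on_vec_differentiable[OF VW(2) x]
      smooth_on_differentiable[OF smooth_on_pullback[OF smooth_on_christoffel] x]
    by (simp add: christoffel_vec_def dir_deriv_sum dir_deriv_mult dir_deriv_pullback[OF smooth_on_christoffel x] vec_differentiable_def dir_deriv_vec_def
        differentiable_sum differentiable_mult distrib_right)
  moreover have "dir_deriv_vec (axis i 1) (\<lambda>y. christoffel_vec g (F y) (V y) (W y)) x $ a =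
      dir_deriv (axis i 1) (\<lambda>y. christoffel_vec g (F y) (V y) (W y) $ a) x" for a
    by (simp add: dir_deriv_vec_def)
  ultimately show ?thesis
    unfolding vec_eq_iff by (simp add: christoffel_vec_deriv_def christoffel_vec_def sum.distrib)
qed

text \<open>
  The terms with first derivatives of \<open>V\<close> are symmetric in \<open>i\<close>, \<open>j\<close>, and so is \<open>\<partial>\<^sub>i F\<^sub>j\<close>; the derivatives and
  products of Christoffel symbols that survive are those of the curvature at \<open>F x\<close>.
\<close>

lemma ricci_identity:
  assumes x: "x \<in> U" and V: "smooth_vec_on U V"
  shows "cov_along i (cov_along j V) x - cov_along j (cov_along i V) x = curv_vec g (F x) (frame F i x) (frame F j x) (V x)"
proof -
  have "cov_along a (cov_along b V) x = dir_deriv_vec (axis a 1) (dir_deriv_vec (axis b 1) V) x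
      + christoffel_vec_deriv g (F x) (frame F a x) (frame F b x) (V x) + christoffel_vec g (F x) (dir_deriv_vec (axis a 1) (frame F b) x) (V x)
      + christoffel_vec g (F x) (frame F b x) (dir_deriv_vec (axis a 1) V x) + christoffel_vec g (F x) (frame F a x) (dir_deriv_vec (axis b 1) V x)
      + christoffel_vec g (F x) (frame F a x) (christoffel_vec g (F x) (frame F b x) (V x))" for a b
  proof -
    have "dir_deriv_vec (axis a 1) (cov_along b V) x = dir_deriv_vec (axis a 1) (dir_deriv_vec (axis b 1) V) x
        + dir_deriv_vec (axis a 1) (\<lambda>y. christoffel_vec g (F y) (frame F b y) (V y)) x"
      unfolding cov_along_def[abs_def]
      by (intro dir_deriv_vec_add smooth_vec_on_vec_differentiable[OF _ x] smooth_vec_on_dir_deriv_vec smooth_vec_on_christoffel_vec V smooth_frame)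
    then show ?thesis
      unfolding cov_along_def[of a] dir_deriv_vec_christoffel_vec[OF x smooth_frame V] cov_along_def[of b V x] christoffel_vec_linear by (simp add: algebra_simps)
  qed
  then show ?thesis
    by (simp add: curv_vec_def dir_deriv_vec_commute[OF open_U x V, of i j] dir_deriv_vec_commute[OF open_U x smooth_F, of i j])
qed

end

section \<open>A complementary pair of half-dimensional frames\<close>

text \<open>
  The Gram matrix of the vectors \<open>e\<close>, \<open>f\<close> is block diagonal with invertible blocks \<open>H\<close> and \<open>s H\<close>, so they are
  linearly independent, and by the count of dimensions they span. It is applied to \<open>e = F\<^sub>p\<close>, \<open>f = A F\<^sub>p\<close>, where
  \<open>s = - \<epsilon>\<close>.
\<close>

lemma orthogonal_to_frames_imp_zero:
  fixes g :: "real^'m^'m" and H :: "real^'n^'n" and e f :: "'n \<Rightarrow> real^'m"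
  assumes dim: "CARD('m) = 2 * CARD('n)" and g: "invertible g" and H: "invertible H" and "s \<noteq> 0"
    and ee: "\<And>i j. e i \<bullet> (g *v e j) = H $ i $ j" and ff: "\<And>i j. f i \<bullet> (g *v f j) = s * H $ i $ j"
    and ef: "\<And>i j. e i \<bullet> (g *v f j) = 0" and fe: "\<And>i j. f i \<bullet> (g *v e j) = 0"
    and v: "\<And>k. v \<bullet> (g *v e k) = 0" "\<And>k. v \<bullet> (g *v f k) = 0"
  shows "v = 0"
proof -
  define \<Phi> where "\<Phi> ab = (\<Sum>p\<in>UNIV. fst ab $ p *\<^sub>R e p) + (\<Sum>p\<in>UNIV. snd ab $ p *\<^sub>R f p)"
    for ab :: "(real^'n) \<times> (real^'n)"
  have lin: "linear \<Phi>"
    by (rule linearI) (simp_all add: \<Phi>_def scaleR_add_left sum.distrib scaleR_sum_right algebra_simps)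
  have H0: "a = 0" if "\<And>k. (\<Sum>p\<in>UNIV. a $ p * H $ p $ k) = 0" for a :: "real^'n"
  proof -
    have "a v* H = 0" using that by (simp add: vector_matrix_mult_def vec_eq_iff mult.commute)
    then have "(a v* H) v* matrix_inv H = 0" by simp
    then show ?thesis by (simp add: vector_matrix_mul_assoc matrix_inv_inverse[OF H])
  qed
  have "ab = 0" if z: "\<Phi> ab = 0" for ab
  proof -
    have "\<Phi> ab \<bullet> (g *v e k) = (\<Sum>p\<in>UNIV. fst ab $ p * H $ p $ k)"
      and "\<Phi> ab \<bullet> (g *v f k) = s * (\<Sum>p\<in>UNIV. snd ab $ p * H $ p $ k)" for k
      by (simp_all add: \<Phi>_def inner_simps inner_sum_left ee ff ef fe sum_distrib_left algebra_simps)
    then have "fst ab = 0" "snd ab = 0" using z \<open>s \<noteq> 0\<close> by (auto intro!: H0)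
    then show ?thesis by (simp add: prod_eq_iff)
  qed
  then have "inj \<Phi>" using lin by (simp add: linear_injective_0)
  then have "dim (range \<Phi>) = dim (UNIV :: ((real^'n) \<times> (real^'n)) set)"
    using lin by (intro dim_image_eq) auto
  then have "dim (range \<Phi>) = DIM(real^'m)" by (simp add: dim)
  then have "span (range \<Phi>) = UNIV" by (simp only: dim_eq_full)
  then have surj: "range \<Phi> = UNIV"
    using lin by (metis linear_span_image span_UNIV)
  \<comment> \<open>\<open>v\<close> is \<open>g\<close>-orthogonal to every vector, in particular to the one that represents \<open>v\<close> itself\<close>
  obtain w where w: "g *v w = v" using g by (metis matrix_inv_inverse(1) matrix_vector_mul_assoc matrix_vector_mul_lid)
  obtain ab where "w = \<Phi> ab" using surj by (metis surjD)
  have "g *v \<Phi> ab = (\<Sum>p\<in>UNIV. fst ab $ p *\<^sub>R (g *v e p)) + (\<Sum>p\<in>UNIV. snd ab $ p *\<^sub>R (g *v f p))"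
    by (simp add: \<Phi>_def matrix_vector_right_distrib linear_sum[OF matrix_vector_mul_linear] matrix_vector_mult_scaleR)
  then have "v \<bullet> v = 0" using w \<open>w = \<Phi> ab\<close> v by (metis (no_types, lifting) inner_add_right inner_sum_right inner_scaleR_right mult_zero_right sum.neutral add.right_neutral)
  then show ?thesis by simp
qed

section \<open>The equations of Gauss and Codazzi for a Lagrangian immersion\<close>

text \<open>
  The data in one pair of charts: \<open>S\<close> is the image of a chart of the target, and \<open>U\<close> is the part of a chart of
  the source that \<open>F\<close> maps into it.
\<close>

locale lagrangian_domain = kaehler_domain S g A \<Omega> \<epsilon> + map_into_metric_domain S g U F
  for S :: "(real^'m) set" and g A \<Omega> :: "real^'m \<Rightarrow> real^'m^'m" and \<epsilon> :: real
    and U :: "(real^'n) set" and F :: "real^'n \<Rightarrow> real^'m" +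
  fixes h :: "real^'n \<Rightarrow> real^'n^'n" and C :: real
  assumes dim: "CARD('m) = 2 * CARD('n)"
    and induced_metric: "x \<in> U \<Longrightarrow> h x $ i $ j = frame F i x \<bullet> (g (F x) *v frame F j x)"
    and induced_inv: "x \<in> U \<Longrightarrow> invertible (h x)"
    and isotropic: "x \<in> U \<Longrightarrow> frame F i x \<bullet> (\<Omega> (F x) *v frame F j x) = 0"
    and curvature: "y \<in> S \<Longrightarrow> Riem g y a b c d =
      - C * (metric_square (g y) a b c d + 3 * \<epsilon> * form_square (\<Omega> y) a b c d)"
begin

definition second_fundamental :: "real^'n \<Rightarrow> 'n \<Rightarrow> 'n \<Rightarrow> 'n \<Rightarrow> real" where
  "second_fundamental x i j k = cov_along i (frame F j) x \<bullet> (\<Omega> (F x) *v frame F k x)"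

lemma smooth_pairing:
  assumes "\<And>i j. smooth_on S (\<lambda>z. T z $ i $ j)" "smooth_vec_on U V" "smooth_vec_on U W"
  shows "smooth_on U (\<lambda>x. V x \<bullet> (T (F x) *v W x))"
  by (intro smooth_on_inner open_U assms smooth_vec_on_matvec)

lemma smooth_induced: "smooth_on U (\<lambda>x. h x $ i $ j)"
  by (rule iffD2[OF smooth_on_cong[OF open_U]], erule induced_metric)
     (rule smooth_pairing[OF smooth_metric smooth_frame smooth_frame])

lemma smooth_second_fundamental: "smooth_on U (\<lambda>x. second_fundamental x i j k)"
  unfolding second_fundamental_def by (intro smooth_pairing smooth_form smooth_cov_along smooth_frame)

sublocale induced: metric_domain U h
proof
  show "transpose (h x) = h x" if "x \<in> U" for x
    using that metric_inner_sym[OF F_in[OF that]] by (simp add: transpose_def vec_eq_iff induced_metric)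
qed (rule open_U smooth_induced induced_inv; assumption)+

lemma pd_induced:
  assumes x: "x \<in> U"
  shows "pd i (\<lambda>y. h y $ j $ k) x =
    cov_along i (frame F j) x \<bullet> (g (F x) *v frame F k x) + cov_along i (frame F k) x \<bullet> (g (F x) *v frame F j x)"
proof -
  have "pd i (\<lambda>y. h y $ j $ k) x = pd i (\<lambda>y. frame F j y \<bullet> (g (F y) *v frame F k y)) x"
    by (rule pd_cong(1)[OF open_U x induced_metric])
  then show ?thesis
    by (simp add: along_parallel[OF metric_parallel smooth_metric x smooth_frame smooth_frame]
        metric_inner_sym[OF F_in[OF x], of "frame F j x"])
qed

text \<open>
  The Gauss formula: by Koszul's argument the tangential part of \<open>\<nabla>\<^sub>i F\<^sub>j\<close> is given by the Levi-Civita connection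
  of the induced metric.
\<close>

lemma tangential_part:
  assumes x: "x \<in> U"
  shows "cov_along i (frame F j) x \<bullet> (g (F x) *v frame F k x) = (\<Sum>p\<in>UNIV. christoffel h x p i j * h x $ p $ k)"
  unfolding induced.christoffel_lowered[OF x] pd_induced[OF x]
  by (simp add: torsion_free[OF x, of k j] torsion_free[OF x, of k i] torsion_free[OF x, of j i])

lemma second_fundamental_sym12: "x \<in> U \<Longrightarrow> second_fundamental x i j k = second_fundamental x j i k"
  unfolding second_fundamental_def by (simp add: torsion_free[of x i j])

lemma second_fundamental_sym23:
  assumes x: "x \<in> U"
  shows "second_fundamental x i j k = second_fundamental x i k j"
proof -
  have "pd i (\<lambda>y. frame F j y \<bullet> (\<Omega> (F y) *v frame F k y)) x = pd i (\<lambda>_. 0) x"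
    by (rule pd_cong(1)[OF open_U x isotropic])
  then have "cov_along i (frame F j) x \<bullet> (\<Omega> (F x) *v frame F k x) + frame F j x \<bullet> (\<Omega> (F x) *v cov_along i (frame F k) x) = 0"
    by (simp add: along_parallel[OF form_parallel smooth_form x smooth_frame smooth_frame])
  then show ?thesis
    unfolding second_fundamental_def form_inner_antisym[OF F_in[OF x], of "frame F j x"] by simp
qed

definition second_fundamental_up :: "real^'n \<Rightarrow> 'n \<Rightarrow> 'n \<Rightarrow> 'n \<Rightarrow> real" where
  "second_fundamental_up x p i j = (\<Sum>q\<in>UNIV. matrix_inv (h x) $ q $ p * second_fundamental x i j q)"

lemma raised_lowered:
  assumes x: "x \<in> U"
  shows "(\<Sum>p\<in>UNIV. second_fundamental_up x p i j * h x $ p $ k) = second_fundamental x i j k"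
proof -
  have "(\<Sum>p\<in>UNIV. second_fundamental_up x p i j * h x $ p $ k) =
      (\<Sum>q\<in>UNIV. (matrix_inv (h x) ** h x) $ q $ k * second_fundamental x i j q)"
    unfolding second_fundamental_up_def matrix_matrix_mult_def vec_lambda_beta sum_distrib_right
    by (subst sum.swap) (intro sum.cong refl, simp add: mult.assoc mult.commute)
  then show ?thesis
    by (simp add: matrix_inv_inverse[OF induced_inv[OF x]] mat_def if_distrib if_distribR cong: if_cong)
qed

text \<open>
  The pairing of \<open>\<nabla>\<^sub>i F\<^sub>j\<close> with \<open>A F\<^sub>k\<close> by \<open>G\<close> is \<open>- \<Pi>\<^sub>i\<^sub>j\<^sub>k\<close>, and \<open>G(A F\<^sub>p, A F\<^sub>k) = - \<epsilon> h\<^sub>p\<^sub>k\<close>; this fixes the coefficient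
  \<open>\<epsilon> \<Pi>\<^sub>i\<^sub>j\<^sup>p = \<Pi>\<^sub>i\<^sub>j\<^sup>p / \<epsilon>\<close> of the normal part. Both sides have the same pairings with all \<open>F\<^sub>k\<close> and \<open>A F\<^sub>k\<close>.
\<close>

lemma frame_decomposition:
  assumes x: "x \<in> U"
  shows "cov_along i (frame F j) x = (\<Sum>p\<in>UNIV. christoffel h x p i j *\<^sub>R frame F p x)
    + \<epsilon> *\<^sub>R (\<Sum>p\<in>UNIV. second_fundamental_up x p i j *\<^sub>R (A (F x) *v frame F p x))"
proof -
  note y = F_in[OF x]
  let ?e = "\<lambda>p. frame F p x" and ?f = "\<lambda>p. A (F x) *v frame F p x" and ?g = "g (F x)"
  have ee: "?e p \<bullet> (?g *v ?e k) = h x $ p $ k" for p k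
    by (simp add: induced_metric[OF x])
  have ef: "?e p \<bullet> (?g *v ?f k) = 0" for p k
    by (simp add: metric_structure[OF y] isotropic[OF x])
  have fe: "?f p \<bullet> (?g *v ?e k) = 0" for p k
    using ef[of k p] metric_inner_sym[OF y] by simp
  have ff: "?f p \<bullet> (?g *v ?f k) = - \<epsilon> * h x $ p $ k" for p k
  proof -
    have "?f p \<bullet> (?g *v ?f k) = - ((A (F x) *v ?f p) \<bullet> (?g *v ?e k))"
      by (simp only: metric_structure[OF y] form_metric[OF y])
    then show ?thesis by (simp add: structure_twice[OF y] ee)
  qed
  have eps0: "- \<epsilon> \<noteq> 0" using eps_sq by auto
  have "cov_along i (frame F j) x - ((\<Sum>p\<in>UNIV. christoffel h x p i j *\<^sub>R ?e p)
    + \<epsilon> *\<^sub>R (\<Sum>p\<in>UNIV. second_fundamental_up x p i j *\<^sub>R ?f p)) = 0"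
  proof (rule orthogonal_to_frames_imp_zero[OF dim metric_inv[OF y] induced_inv[OF x] eps0 ee ff ef fe])
    show "(cov_along i (frame F j) x - ((\<Sum>p\<in>UNIV. christoffel h x p i j *\<^sub>R ?e p)
        + \<epsilon> *\<^sub>R (\<Sum>p\<in>UNIV. second_fundamental_up x p i j *\<^sub>R ?f p))) \<bullet> (?g *v ?e k) = 0" for k
      by (simp add: inner_simps inner_sum_left tangential_part[OF x] ee fe)
    show "(cov_along i (frame F j) x - ((\<Sum>p\<in>UNIV. christoffel h x p i j *\<^sub>R ?e p)
        + \<epsilon> *\<^sub>R (\<Sum>p\<in>UNIV. second_fundamental_up x p i j *\<^sub>R ?f p))) \<bullet> (?g *v ?f k) = 0" for k
    proof -
      have "cov_along i (frame F j) x \<bullet> (?g *v ?f k) = - second_fundamental x i j k"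
        by (simp add: metric_structure[OF y] second_fundamental_def)
      moreover have "(\<Sum>p\<in>UNIV. christoffel h x p i j *\<^sub>R ?e p) \<bullet> (?g *v ?f k) = 0"
        by (simp add: inner_sum_left ef)
      moreover have "(\<Sum>p\<in>UNIV. second_fundamental_up x p i j *\<^sub>R ?f p) \<bullet> (?g *v ?f k) = - \<epsilon> * second_fundamental x i j k"
        unfolding raised_lowered[OF x, symmetric] sum_distrib_left inner_sum_left inner_scaleR_left ff
        by (intro sum.cong refl) simp
      moreover have "\<epsilon> * (- \<epsilon> * second_fundamental x i j k) = - second_fundamental x i j k"
        using eps_sq by (simp add: mult.assoc[symmetric])
      ultimately show ?thesis
        by (simp only: inner_diff_left inner_add_left inner_scaleR_left)
    qed
  qed
  then show ?thesis by simp
qed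

text \<open>
  The terms that remain besides the curvature when \<open>G(\<nabla>\<^sub>j F\<^sub>k, F\<^sub>l)\<close> is differentiated. It suffices to decompose the
  first factor, as the pairings of the frame with \<open>\<nabla>\<^sub>i F\<^sub>l\<close> are known.
\<close>

lemma pairing_cov_metric:
  assumes x: "x \<in> U"
  shows "cov_along j (frame F k) x \<bullet> (g (F x) *v cov_along i (frame F l) x) =
    (\<Sum>p\<in>UNIV. christoffel h x p j k * (\<Sum>q\<in>UNIV. christoffel h x q i l * h x $ q $ p))
    - \<epsilon> * (\<Sum>p\<in>UNIV. second_fundamental_up x p j k * second_fundamental x i l p)"
proof -
  note y = F_in[OF x]
  let ?D = "cov_along i (frame F l) x"
  have 1: "frame F p x \<bullet> (g (F x) *v ?D) = (\<Sum>q\<in>UNIV. christoffel h x q i l * h x $ q $ p)" for p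
    by (simp add: metric_inner_sym[OF y, of _ ?D] tangential_part[OF x])
  have 2: "(A (F x) *v frame F p x) \<bullet> (g (F x) *v ?D) = - second_fundamental x i l p" for p
    unfolding form_metric[OF y, symmetric] second_fundamental_def by (rule form_inner_antisym[OF y])
  show ?thesis
    by (subst frame_decomposition[OF x]) (simp add: inner_simps inner_sum_left 1 2 sum_negf)
qed

text \<open>
  By \<open>\<Omega>(A X, Y) = \<epsilon> G(X, Y)\<close>, the normal part of the first factor pairs with the tangential part of the
  second one, so that the two factors \<open>\<epsilon>\<close> cancel.
\<close>

lemma pairing_cov_form:
  assumes x: "x \<in> U"
  shows "cov_along j (frame F k) x \<bullet> (\<Omega> (F x) *v cov_along i (frame F l) x) =
    (\<Sum>p\<in>UNIV. christoffel h x p i l * second_fundamental x j k p)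
    - (\<Sum>p\<in>UNIV. christoffel h x p j k * second_fundamental x i l p)"
proof -
  note y = F_in[OF x]
  let ?D = "cov_along i (frame F l) x"
  have 1: "frame F p x \<bullet> (\<Omega> (F x) *v ?D) = - second_fundamental x i l p" for p
    unfolding second_fundamental_def by (rule form_inner_antisym[OF y])
  have 2: "(A (F x) *v frame F p x) \<bullet> (\<Omega> (F x) *v ?D) = \<epsilon> * (\<Sum>q\<in>UNIV. christoffel h x q i l * h x $ q $ p)" for p
    by (simp add: form_metric[OF y] structure_twice[OF y] metric_inner_sym[OF y, of _ ?D] tangential_part[OF x]
        matrix_vector_mult_scaleR)
  have "(\<Sum>p\<in>UNIV. second_fundamental_up x p j k * (\<Sum>q\<in>UNIV. christoffel h x q i l * h x $ q $ p)) =
      (\<Sum>q\<in>UNIV. christoffel h x q i l * (\<Sum>p\<in>UNIV. second_fundamental_up x p j k * h x $ p $ q))"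
    unfolding sum_distrib_left
    by (subst sum.swap) (intro sum.cong refl, simp add: induced.metric_entry_sym[OF x] algebra_simps)
  also have "\<dots> = (\<Sum>p\<in>UNIV. christoffel h x p i l * second_fundamental x j k p)"
    by (simp add: raised_lowered[OF x])
  finally have "\<epsilon> * \<epsilon> * (\<Sum>p\<in>UNIV. second_fundamental_up x p j k * (\<Sum>q\<in>UNIV. christoffel h x q i l * h x $ q $ p)) =
      (\<Sum>p\<in>UNIV. christoffel h x p i l * second_fundamental x j k p)"
    by (simp add: eps_sq)
  moreover have "\<epsilon> * (\<Sum>p\<in>UNIV. second_fundamental_up x p j k * (\<epsilon> * (\<Sum>q\<in>UNIV. christoffel h x q i l * h x $ q $ p))) =
      \<epsilon> * \<epsilon> * (\<Sum>p\<in>UNIV. second_fundamental_up x p j k * (\<Sum>q\<in>UNIV. christoffel h x q i l * h x $ q $ p))"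
    unfolding sum_distrib_left by (intro sum.cong refl) (simp add: ac_simps)
  ultimately have 3: "\<epsilon> * (\<Sum>p\<in>UNIV. second_fundamental_up x p j k * (\<epsilon> * (\<Sum>q\<in>UNIV. christoffel h x q i l * h x $ q $ p))) =
      (\<Sum>p\<in>UNIV. christoffel h x p i l * second_fundamental x j k p)"
    by simp
  show ?thesis
    by (subst frame_decomposition[OF x]) (simp add: inner_simps inner_sum_left 1 2 3 sum_negf)
qed

text \<open>
  On tangent vectors the curvature formula loses all its terms with \<open>\<Omega>\<close>. For the second part the
  same formula is evaluated on the normal vector \<open>A F\<^sub>l\<close>, using \<open>\<Omega>(X, Y) = - G(X, A Y)\<close>.
\<close>

lemma ambient_curvature_tangential:
  assumes x: "x \<in> U"
  shows "curv_vec g (F x) (frame F i x) (frame F j x) (frame F k x) \<bullet> (g (F x) *v frame F l x) =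
      - C * metric_square (h x) i j k l"
    and "curv_vec g (F x) (frame F i x) (frame F j x) (frame F k x) \<bullet> (\<Omega> (F x) *v frame F l x) = 0"
proof -
  note y = F_in[OF x]
  note R = const_curvature[OF curvature[OF y]]
  show "curv_vec g (F x) (frame F i x) (frame F j x) (frame F k x) \<bullet> (g (F x) *v frame F l x) =
      - C * metric_square (h x) i j k l"
    by (simp add: R isotropic[OF x] induced_metric[OF x] metric_square_def)
  have "curv_vec g (F x) (frame F i x) (frame F j x) (frame F k x) \<bullet> (g (F x) *v (A (F x) *v frame F l x)) = 0"
    unfolding R by (simp add: isotropic[OF x] metric_structure[OF y])
  then show "curv_vec g (F x) (frame F i x) (frame F j x) (frame F k x) \<bullet> (\<Omega> (F x) *v frame F l x) = 0"
    by (simp add: metric_structure[OF y])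
qed

lemma cubic_square_raised:
  assumes x: "x \<in> U"
  shows "cubic_square (h x) (second_fundamental x) i j k l =
    (\<Sum>p\<in>UNIV. second_fundamental_up x p i k * second_fundamental x j l p) - (\<Sum>p\<in>UNIV. second_fundamental_up x p j k * second_fundamental x i l p)"
proof -
  have "(\<Sum>p\<in>UNIV. second_fundamental_up x p a k * second_fundamental x b l p) =
      (\<Sum>q\<in>UNIV. \<Sum>p\<in>UNIV. matrix_inv (h x) $ q $ p * (second_fundamental x k a q * second_fundamental x b l p))" for a b
    unfolding second_fundamental_up_def sum_distrib_right
    by (subst sum.swap) (simp add: mult.assoc second_fundamental_sym12[OF x, of a k])
  then show ?thesis
    by (simp add: cubic_square_def right_diff_distrib sum_subtractf)
qed

text \<open>
  In \<open>Riem_lowered\<close> for \<open>h\<close>, the derivatives of the lowered Christoffel symbols are derivatives of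
  \<open>G(\<nabla>\<^sub>j F\<^sub>k, F\<^sub>l)\<close>. The products of Christoffel symbols cancel against the tangential parts in \<open>pairing_cov_metric\<close>.
\<close>

lemma gauss_equation:
  assumes x: "x \<in> U"
  shows "Riem h x i j k l - \<epsilon> * cubic_square (h x) (second_fundamental x) i j k l = - C * metric_square (h x) i j k l"
proof -
  have pdL: "pd a (\<lambda>y. \<Sum>p\<in>UNIV. christoffel h y p b k * h y $ p $ l) x =
      cov_along a (cov_along b (frame F k)) x \<bullet> (g (F x) *v frame F l x)
      + cov_along b (frame F k) x \<bullet> (g (F x) *v cov_along a (frame F l) x)" for a b
  proof -
    have "pd a (\<lambda>y. \<Sum>p\<in>UNIV. christoffel h y p b k * h y $ p $ l) x =
        pd a (\<lambda>y. cov_along b (frame F k) y \<bullet> (g (F y) *v frame F l y)) x"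
      by (rule pd_cong(1)[OF open_U x]) (simp add: tangential_part)
    then show ?thesis
      by (simp add: along_parallel[OF metric_parallel smooth_metric x smooth_cov_along[OF smooth_frame] smooth_frame])
  qed
  have "Riem h x i j k l =
      (cov_along i (cov_along j (frame F k)) x - cov_along j (cov_along i (frame F k)) x) \<bullet> (g (F x) *v frame F l x)
      + \<epsilon> * cubic_square (h x) (second_fundamental x) i j k l"
    unfolding induced.Riem_lowered[OF x] pdL pairing_cov_metric[OF x] cubic_square_raised[OF x]
    by (simp add: inner_simps algebra_simps)
  then show ?thesis
    by (simp add: ricci_identity[OF x smooth_frame] ambient_curvature_tangential[OF x])
qed

text \<open>
  Antisymmetrized in \<open>i\<close>, \<open>j\<close>, the derivatives \<open>\<partial>\<^sub>i \<Omega>(\<nabla>\<^sub>j F\<^sub>k, F\<^sub>l)\<close> leave only the Christoffel terms of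
  \<open>pairing_cov_form\<close>. By the symmetry of \<open>\<Pi>\<close> and \<open>\<Gamma>\<close> they cancel the correction terms of the covariant derivative.
\<close>

lemma codazzi_equation:
  assumes x: "x \<in> U"
  shows "cov_deriv3 h second_fundamental x i j k l = cov_deriv3 h second_fundamental x j i k l"
proof -
  have pdP: "pd a (\<lambda>y. second_fundamental y b k l) x =
      cov_along a (cov_along b (frame F k)) x \<bullet> (\<Omega> (F x) *v frame F l x)
      + cov_along b (frame F k) x \<bullet> (\<Omega> (F x) *v cov_along a (frame F l) x)" for a b
    unfolding second_fundamental_def
    by (rule along_parallel[OF form_parallel smooth_form x smooth_cov_along[OF smooth_frame] smooth_frame])
  have "(cov_along i (cov_along j (frame F k)) x - cov_along j (cov_along i (frame F k)) x) \<bullet> (\<Omega> (F x) *v frame F l x) = 0"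
    by (simp add: ricci_identity[OF x smooth_frame] ambient_curvature_tangential[OF x])
  then have R: "cov_along i (cov_along j (frame F k)) x \<bullet> (\<Omega> (F x) *v frame F l x) =
      cov_along j (cov_along i (frame F k)) x \<bullet> (\<Omega> (F x) *v frame F l x)"
    by (simp add: inner_simps)
  have s: "second_fundamental x a p l = second_fundamental x a l p" for a p
    by (rule second_fundamental_sym23[OF x])
  show ?thesis
    unfolding cov_deriv3_def pdP pairing_cov_form[OF x] R
    by (simp add: sum.distrib s induced.christoffel_sym[OF x, of _ i j])
qed

end

section \<open>Charts\<close>

lemma jacobian_entry:
  assumes "vec_differentiable F x" shows "jacobian F (at x) $ a $ i = pd i (\<lambda>y. F y $ a) x"
proof -
  have "frechet_derivative F (at x) = (\<lambda>v. \<chi> b. \<Sum>i\<in>UNIV. v $ i * pd i (\<lambda>y. F y $ b) x)"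
    using vec_has_derivative_pd[of F x] assms by (intro frechet_derivative_at[symmetric]) (simp add: vec_differentiable_def)
  then show ?thesis by (simp add: jacobian_def matrix_def)
qed

lemma jacobian_axis: "vec_differentiable F x \<Longrightarrow> jacobian F (at x) *v axis i 1 = dir_deriv_vec (axis i 1) F x"
  by (simp add: matrix_vector_mult_basis column_def jacobian_entry dir_deriv_vec_def dir_deriv_axis)

lemma pullback_entry:
  assumes "vec_differentiable F x"
  shows "(transpose (jacobian F (at x)) ** T ** jacobian F (at x)) $ i $ j = frame F i x \<bullet> (T *v frame F j x)"
proof -
  let ?J = "jacobian F (at x)"
  have "(transpose ?J ** T ** ?J) $ i $ j = axis i 1 \<bullet> (transpose ?J *v (T *v (?J *v axis j 1)))"
    unfolding axis_inner_matvec[symmetric] by (simp add: matrix_vector_mul_assoc matrix_mul_assoc)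
  also have "\<dots> = (?J *v axis i 1) \<bullet> (T *v (?J *v axis j 1))"
    by (metis dot_lmul_matrix inner_commute transpose_matrix_vector)
  finally show ?thesis by (simp add: jacobian_axis assms)
qed

lemma chart_inj_on:
  assumes "smooth_manifold X \<A>" "c \<in> \<A>" shows "inj_on (snd c) (fst c)"
proof -
  have "openin X (fst c)" and "homeomorphic_map (subtopology X (fst c)) (top_of_set (chart_image c)) (snd c)"
    using assms by (auto simp: smooth_manifold_def)
  from homeomorphic_imp_injective_map[OF this(2)] openin_subset[OF this(1)]
  show ?thesis by (simp add: Int_absorb1)
qed

lemma open_chart_image: "smooth_manifold X \<A> \<Longrightarrow> c \<in> \<A> \<Longrightarrow> open (chart_image c)"
  by (simp add: smooth_manifold_def)

lemma coord_rep_apply: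
  assumes "smooth_manifold X \<A>" "c \<in> \<A>" "p \<in> fst c"
  shows "coord_rep f c d (snd c p) = snd d (f p)"
  using chart_inj_on[OF assms(1,2)] assms(3) by (simp add: coord_rep_def)

lemma open_coord_dom:
  assumes X: "smooth_manifold X \<A>" "c \<in> \<A>" and Y: "smooth_manifold Y \<B>" "d \<in> \<B>"
    and f: "continuous_map X Y f"
  shows "open (coord_dom f c d)"
proof -
  have c: "openin X (fst c)" "open (chart_image c)"
      "homeomorphic_map (subtopology X (fst c)) (top_of_set (chart_image c)) (snd c)"
    using X by (auto simp: smooth_manifold_def)
  have "openin Y (fst d)" using Y by (auto simp: smooth_manifold_def)
  then have "openin X (fst c \<inter> {x \<in> topspace X. f x \<in> fst d})"
    using f c(1) by (intro openin_Int openin_continuous_map_preimage)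
  moreover have "fst c \<inter> {x \<in> topspace X. f x \<in> fst d} = fst c \<inter> f -` fst d"
    using openin_subset[OF c(1)] by auto
  ultimately have "openin (subtopology X (fst c)) (fst c \<inter> f -` fst d)"
    by (auto simp: openin_subtopology)
  then have "openin (top_of_set (chart_image c)) (coord_dom f c d)"
    using homeomorphic_imp_open_map[OF c(3)] by (simp add: open_map_def coord_dom_def)
  then show ?thesis using c(2) by (simp add: openin_open_eq)
qed

lemma coord_dom_subset: "coord_dom f c d \<subseteq> chart_image c"
  by (auto simp: coord_dom_def chart_image_def)

lemma coord_rep_into:
  assumes "smooth_manifold X \<A>" "c \<in> \<A>"
  shows "coord_rep f c d ` coord_dom f c d \<subseteq> chart_image d"
  by (auto simp: coord_dom_def chart_image_def coord_rep_apply[OF assms])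

lemma coord_dom_cover:
  assumes X: "smooth_manifold X \<A>" "c \<in> \<A>" and Y: "smooth_manifold Y \<B>"
    and f: "continuous_map X Y f" and x: "x \<in> chart_image c"
  obtains d where "d \<in> \<B>" "x \<in> coord_dom f c d"
proof -
  obtain p where p: "p \<in> fst c" "x = snd c p" using x by (auto simp: chart_image_def)
  then have "p \<in> topspace X" using X openin_subset by (fastforce simp: smooth_manifold_def)
  then have "f p \<in> topspace Y" using f by (auto simp: continuous_map_def)
  moreover have "(\<Union>d\<in>\<B>. fst d) = topspace Y" using Y by (simp add: smooth_manifold_def)
  ultimately obtain d where "d \<in> \<B>" "f p \<in> fst d" by blast
  then show thesis using p by (intro that) (auto simp: coord_dom_def)
qed

section \<open>Change of coordinates on the source\<close>

lemma frame_compose: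
  assumes "open W" "y \<in> W" and F: "\<And>z. z \<in> W \<Longrightarrow> F z = F' (\<phi> z)"
    and "vec_differentiable \<phi> y" "vec_differentiable F' (\<phi> y)"
  shows "frame F j y $ a = (\<Sum>q\<in>UNIV. frame \<phi> j y $ q * frame F' q (\<phi> y) $ a)"
proof -
  have "frame F j y $ a = pd j (\<lambda>z. F' (\<phi> z) $ a) y"
    using pd_cong(1)[OF assms(1,2), of "\<lambda>z. F z $ a"] F by (simp add: dir_deriv_vec_def dir_deriv_axis)
  also have "\<dots> = (\<Sum>q\<in>UNIV. pd q (\<lambda>z. F' z $ a) (\<phi> y) * pd j (\<lambda>z. \<phi> z $ q) y)"
    using assms by (intro pd_chain(2)[of \<phi> y "\<lambda>z. F' z $ a"]) (auto simp: vec_differentiable_def)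
  finally show ?thesis by (simp add: dir_deriv_vec_def dir_deriv_axis mult.commute)
qed

lemma jacobian_compose:
  assumes "open W" "y \<in> W" and F: "\<And>z. z \<in> W \<Longrightarrow> F z = F' (\<phi> z)"
    and "vec_differentiable \<phi> y" "vec_differentiable F' (\<phi> y)" "vec_differentiable F y"
  shows "jacobian F (at y) = jacobian F' (at (\<phi> y)) ** jacobian \<phi> (at y)"
  using frame_compose[where W = W and F = F and F' = F' and \<phi> = \<phi>, OF assms(1-5)] assms(4-6)
  by (simp add: vec_eq_iff matrix_matrix_mult_def jacobian_entry dir_deriv_vec_def dir_deriv_axis mult.commute)

text \<open>
  If \<open>F = F' \<circ> \<phi>\<close>, then \<open>F\<^sub>j = \<partial>\<^sub>j \<phi>\<^sup>q F'\<^sub>q\<close> and \<open>\<nabla>\<^sub>i F\<^sub>j = \<partial>\<^sub>i \<partial>\<^sub>j \<phi>\<^sup>q F'\<^sub>q + \<partial>\<^sub>i \<phi>\<^sup>p \<partial>\<^sub>j \<phi>\<^sup>q \<nabla>\<^sub>p F'\<^sub>q\<close>. The first term is not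
  tensorial, but it is tangential, and \<open>\<Omega>\<close> vanishes on pairs of tangent vectors.
\<close>

lemma second_fundamental_transform:
  fixes S :: "(real^'m) set" and U U' W :: "(real^'n) set" and \<phi> :: "real^'n \<Rightarrow> real^'n"
  assumes L: "lagrangian_domain S g A \<Omega> \<epsilon> U F h C" and L': "lagrangian_domain S g A \<Omega> \<epsilon> U' F' h' C"
    and W: "open W" "x \<in> W" "W \<subseteq> U" and \<phi>: "smooth_vec_on W \<phi>" "\<phi> ` W \<subseteq> U'"
    and F: "\<And>y. y \<in> W \<Longrightarrow> F y = F' (\<phi> y)"
  shows "lagrangian_domain.second_fundamental g \<Omega> F x i j k =
    (\<Sum>p\<in>UNIV. \<Sum>q\<in>UNIV. \<Sum>r\<in>UNIV. lagrangian_domain.second_fundamental g \<Omega> F' (\<phi> x) p q r *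
      frame \<phi> i x $ p * frame \<phi> j x $ q * frame \<phi> k x $ r)"
proof -
  interpret u: lagrangian_domain S g A \<Omega> \<epsilon> U F h C by (rule L)
  interpret v: lagrangian_domain S g A \<Omega> \<epsilon> U' F' h' C by (rule L')
  have x: "x \<in> U" "\<phi> x \<in> U'" "F x = F' (\<phi> x)" using W \<phi> F by auto
  have comp: "frame F j y $ a = (\<Sum>q\<in>UNIV. frame \<phi> j y $ q * frame F' q (\<phi> y) $ a)" if "y \<in> W" for y j a
    using that \<phi> by (intro frame_compose[where W = W and F = F and F' = F' and \<phi> = \<phi>, OF W(1) that F] smooth_vec_on_vec_differentiable[OF \<phi>(1)]
        smooth_vec_on_vec_differentiable[OF v.smooth_F]) auto
  then have comp_vec: "frame F j x = (\<Sum>q\<in>UNIV. frame \<phi> j x $ q *\<^sub>R frame F' q (\<phi> x))" for j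
    by (simp add: vec_eq_iff W)
  have second: "dir_deriv_vec (axis i 1) (frame F j) x = (\<Sum>q\<in>UNIV. dir_deriv_vec (axis i 1) (frame \<phi> j) x $ q *\<^sub>R frame F' q (\<phi> x))
      + (\<Sum>q\<in>UNIV. \<Sum>p\<in>UNIV. (frame \<phi> i x $ p * frame \<phi> j x $ q) *\<^sub>R dir_deriv_vec (axis p 1) (frame F' q) (\<phi> x))"
  proof -
    have d\<phi>: "vec_differentiable (frame \<phi> j) x"
      by (rule smooth_vec_on_vec_differentiable[OF smooth_vec_on_dir_deriv_vec[OF \<phi>(1)] W(2)])
    have dF: "vec_differentiable (frame F' q) (\<phi> x)" for q
      by (rule smooth_vec_on_vec_differentiable[OF v.smooth_frame x(2)])
    have d\<phi>0: "vec_differentiable \<phi> x" by (rule smooth_vec_on_vec_differentiable[OF \<phi>(1) W(2)])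
    have chain: "pd i (\<lambda>y. frame F' q (\<phi> y) $ a) x = (\<Sum>p\<in>UNIV. frame \<phi> i x $ p * dir_deriv_vec (axis p 1) (frame F' q) (\<phi> x) $ a)"
      and diff: "(\<lambda>y. frame F' q (\<phi> y) $ a) differentiable (at x)" for q a
      using pd_chain(1)[of \<phi> x "\<lambda>z. frame F' q z $ a"] pd_chain(2)[of \<phi> x "\<lambda>z. frame F' q z $ a" i] d\<phi>0 dF[of q]
      by (simp_all add: vec_differentiable_def dir_deriv_vec_def[of _ \<phi>] dir_deriv_vec_def[of _ "frame F' q"] dir_deriv_axis mult.commute)
    have "dir_deriv_vec (axis i 1) (frame F j) x $ a =
      pd i (\<lambda>y. \<Sum>q\<in>UNIV. frame \<phi> j y $ q * frame F' q (\<phi> y) $ a) x" for a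
      using pd_cong(1)[OF W(1,2) comp] by (simp add: dir_deriv_vec_def[of _ "frame F j"] dir_deriv_axis)
    also have "\<dots> a = (\<Sum>q\<in>UNIV. dir_deriv_vec (axis i 1) (frame \<phi> j) x $ q * frame F' q (\<phi> x) $ a
        + frame \<phi> j x $ q * (\<Sum>p\<in>UNIV. frame \<phi> i x $ p * dir_deriv_vec (axis p 1) (frame F' q) (\<phi> x) $ a))" for a
      using d\<phi> diff
      by (simp add: pd_sum pd_mult chain differentiable_mult vec_differentiable_def dir_deriv_vec_def[of _ "frame \<phi> j"] dir_deriv_axis)
    finally show ?thesis
      by (simp add: vec_eq_iff sum.distrib sum_distrib_left ac_simps)
  qed
  have christoffel_vec: "christoffel_vec g (F x) (frame F i x) (frame F j x) =
      (\<Sum>q\<in>UNIV. \<Sum>p\<in>UNIV. (frame \<phi> i x $ p * frame \<phi> j x $ q) *\<^sub>R christoffel_vec g (F' (\<phi> x)) (frame F' p (\<phi> x)) (frame F' q (\<phi> x)))"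
  proof -
    have l1: "linear (\<lambda>X. christoffel_vec g y X Y)" and l2: "linear (\<lambda>Y. christoffel_vec g y X Y)" for X Y y
      by (auto intro!: linearI simp: christoffel_vec_linear)
    show ?thesis
      unfolding comp_vec linear_sum[OF l2] linear_cmul[OF l2] x(3)
      by (simp add: linear_sum[OF l1] linear_cmul[OF l1] scaleR_sum_right mult.commute)
  qed
  have cov_along: "u.cov_along i (frame F j) x = (\<Sum>q\<in>UNIV. dir_deriv_vec (axis i 1) (frame \<phi> j) x $ q *\<^sub>R frame F' q (\<phi> x))
      + (\<Sum>q\<in>UNIV. \<Sum>p\<in>UNIV. (frame \<phi> i x $ p * frame \<phi> j x $ q) *\<^sub>R v.cov_along p (frame F' q) (\<phi> x))"
    unfolding u.cov_along_def v.cov_along_def second christoffel_vec by (simp add: scaleR_add_right sum.distrib)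
  have lin: "linear (\<lambda>Y. \<Omega> (F' (\<phi> x)) *v Y)" by (rule matrix_vector_mul_linear)
  have "u.second_fundamental x i j k = (\<Sum>r\<in>UNIV. \<Sum>q\<in>UNIV. \<Sum>p\<in>UNIV.
      v.second_fundamental (\<phi> x) p q r * frame \<phi> i x $ p * frame \<phi> j x $ q * frame \<phi> k x $ r)"
    unfolding u.second_fundamental_def cov_along comp_vec[of k] x(3)
    by (simp add: linear_sum[OF lin] linear_cmul[OF lin] inner_sum_right inner_sum_left inner_add_left
        v.isotropic[OF x(2)] v.second_fundamental_def sum_distrib_left sum_distrib_right ac_simps)
  also have "\<dots> = (\<Sum>p\<in>UNIV. \<Sum>q\<in>UNIV. \<Sum>r\<in>UNIV.
      v.second_fundamental (\<phi> x) p q r * frame \<phi> i x $ p * frame \<phi> j x $ q * frame \<phi> k x $ r)"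
    by (subst sum.swap, subst (2) sum.swap, subst sum.swap) (rule refl)
  finally show ?thesis .
qed

section \<open>Lagrangian immersions of manifolds\<close>

lemma smooth_vec_on_subset: "smooth_vec_on S F \<Longrightarrow> T \<subseteq> S \<Longrightarrow> smooth_vec_on T F"
  by (auto simp: smooth_vec_on_def intro: smooth_on_subset)

lemma kaehler_domain_chart:
  assumes N: "smooth_manifold XN N" and K: "kaehler_structure N \<epsilon> G A \<Omega>" and eps: "\<epsilon> \<in> {-1, 1}"
    and d: "d \<in> N"
  shows "kaehler_domain (chart_image d) (G d) (A d) (\<Omega> d) \<epsilon>"
proof unfold_locales
  note defs = kaehler_structure_def pseudo_riemannian_metric_def integrable_structure_def symplectic_form_def
    cov2_field_def endo_field_def smooth_comps2_def nondegenerate2_def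
  show "open (chart_image d)" by (rule open_chart_image[OF N d])
  show "smooth_on (chart_image d) (\<lambda>x. G d x $ i $ j)" "smooth_on (chart_image d) (\<lambda>x. A d x $ i $ j)"
    "smooth_on (chart_image d) (\<lambda>x. \<Omega> d x $ i $ j)" for i j
    using K d by (simp_all add: defs)
  show "\<epsilon> * \<epsilon> = 1" using eps by auto
  fix x assume x: "x \<in> chart_image d"
  show "transpose (G d x) = G d x" "invertible (G d x)"
    using K d x by (simp_all add: defs)
  show "A d x ** A d x = \<epsilon> *\<^sub>R mat 1" "nijenhuis (A d) x k i j = 0" for i j k
    using K d x by (simp_all add: defs)
  show "transpose (\<Omega> d x) = - \<Omega> d x"
    "pd i (\<lambda>y. \<Omega> d y $ j $ k) x + pd j (\<lambda>y. \<Omega> d y $ k $ i) x + pd k (\<lambda>y. \<Omega> d y $ i $ j) x = 0" for i j k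
    using K d x by (simp_all add: defs)
  show "X \<bullet> (\<Omega> d x *v Y) = (A d x *v X) \<bullet> (G d x *v Y)" for X Y
    using K d x by (simp add: defs)
qed

theorem theorem4p2:
  fixes XM :: "'a topology" and M :: "('a, 'n::finite) atlas"
    and XN :: "'b topology" and N :: "('b, 'm::finite) atlas"
    and G A \<Omega> :: "('b, 'm) tensor2" and f :: "'a \<Rightarrow> 'b"
    and h :: "('a, 'n) tensor2" and P :: "('a, 'n) tensor3"
    and \<epsilon> chat :: real
  assumes dim_M: "CARD('n) \<ge> 2" and dim_N: "CARD('m) = 2 * CARD('n)"
    and eps: "\<epsilon> \<in> {-1, 1}"
    and manifold_M: "smooth_manifold XM M"
    and manifold_N: "smooth_manifold XN N"
    and kaehler: "kaehler_structure N \<epsilon> G A \<Omega>"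
    and curvature: "const_hol_sec_curv N \<epsilon> G \<Omega> chat"
    and imm: "immersion XM M XN N f"
    and lagr: "lagrangian M N \<Omega> f"
    and induced: "is_pullback2 M N f G h"
    and nondeg: "nondegenerate2 M h"
    and second_ff: "is_second_fundamental_tensor M N G \<Omega> f P"
    and mean_curv_zero: "trace_free3 M h P"
  shows "coupled_projectively_flat M h P \<epsilon> (chat * real CARD('n) * (real CARD('n) - 1))"
proof -
  let ?F = "\<lambda>c d. coord_rep f c d" and ?U = "\<lambda>c d. coord_dom f c d"
  have cont: "continuous_map XM XN f"
    and smooth: "\<And>c d. c \<in> M \<Longrightarrow> d \<in> N \<Longrightarrow> smooth_vec_on (?U c d) (?F c d)"
    using imm by (auto simp: immersion_def smooth_map_def)
  have open_dom: "open (?U c d)" if "c \<in> M" "d \<in> N" for c d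
    by (rule open_coord_dom[OF manifold_M that(1) manifold_N that(2) cont])
  have cover: "\<exists>d\<in>N. x \<in> ?U c d" if "c \<in> M" "x \<in> chart_image c" for c x
    using coord_dom_cover[OF manifold_M that(1) manifold_N cont that(2)] by blast
  have L: "lagrangian_domain (chart_image d) (G d) (A d) (\<Omega> d) \<epsilon> (?U c d) (?F c d) (h c) chat"
    if c: "c \<in> M" and d: "d \<in> N" for c d
  proof -
    interpret kaehler_domain "chart_image d" "G d" "A d" "\<Omega> d" \<epsilon>
      by (rule kaehler_domain_chart[OF manifold_N kaehler eps d])
    show ?thesis
    proof unfold_locales
      show "open (?U c d)" "smooth_vec_on (?U c d) (?F c d)"
        by (rule open_dom[OF c d], rule smooth[OF c d])
      show "?F c d ` ?U c d \<subseteq> chart_image d" by (rule coord_rep_into[OF manifold_M c])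
      show "CARD('m) = 2 * CARD('n)" by (rule dim_N)
      show "Riem (G d) y i j k l = - chat * (metric_square (G d y) i j k l + 3 * \<epsilon> * form_square (\<Omega> d y) i j k l)"
        if "y \<in> chart_image d" for y i j k l
        using curvature d that by (simp add: const_hol_sec_curv_def)
      fix x assume x: "x \<in> ?U c d"
      then have vd: "vec_differentiable (?F c d) x" by (rule smooth_vec_on_vec_differentiable[OF smooth[OF c d]])
      show "invertible (h c x)"
        using nondeg c subsetD[OF coord_dom_subset x] by (simp add: nondegenerate2_def)
      have "h c x = transpose (jacobian (?F c d) (at x)) ** G d (?F c d x) ** jacobian (?F c d) (at x)"
        using induced c d x by (simp add: is_pullback2_def Let_def)
      then show "h c x $ i $ j = frame (?F c d) i x \<bullet> (G d (?F c d x) *v frame (?F c d) j x)" for i j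
        by (simp add: pullback_entry[OF vd])
      have "transpose (jacobian (?F c d) (at x)) ** \<Omega> d (?F c d x) ** jacobian (?F c d) (at x) = 0"
        using lagr c d x unfolding lagrangian_def is_pullback2_def Let_def by simp
      then show "frame (?F c d) i x \<bullet> (\<Omega> d (?F c d x) *v frame (?F c d) j x) = 0" for i j
        by (simp add: pullback_entry[OF vd, symmetric])
    qed
  qed
  have P: "P c x i j k = lagrangian_domain.second_fundamental (G d) (\<Omega> d) (?F c d) x i j k"
    if c: "c \<in> M" and d: "d \<in> N" and x: "x \<in> ?U c d" for c d x i j k
  proof -
    interpret lagrangian_domain "chart_image d" "G d" "A d" "\<Omega> d" \<epsilon> "?U c d" "?F c d" "h c" chat
      by (rule L[OF c d])
    \<comment> \<open>the components of \<open>P\<close> are its values on the constant coordinate fields\<close>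
    let ?e = "\<lambda>i (_::real^'n). axis i (1::real)"
    have sm: "smooth_vec_on (chart_image c) (?e i)" for i by (simp add: smooth_vec_on_def)
    have push: "push (?F c d) (?e i) y = frame (?F c d) i y" if "y \<in> ?U c d" for y i
      unfolding push_def by (rule jacobian_axis[OF smooth_vec_on_vec_differentiable[OF smooth[OF c d] that]])
    have "(\<Sum>a\<in>UNIV. \<Sum>b\<in>UNIV. \<Sum>e\<in>UNIV. P c x a b e * ?e i x $ a * ?e j x $ b * ?e k x $ e) =
        cov_deriv_along (G d) (?F c d) (?e i) (push (?F c d) (?e j)) x \<bullet> (\<Omega> d (?F c d x) *v push (?F c d) (?e k) x)"
      using second_ff c d x sm unfolding is_second_fundamental_tensor_def Let_def by blast
    moreover have "cov_deriv_along (G d) (?F c d) (?e i) (push (?F c d) (?e j)) x = cov_along i (frame (?F c d) j) x"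
    proof -
      have "pd i (\<lambda>y. push (?F c d) (?e j) y $ a) x = pd i (\<lambda>y. frame (?F c d) j y $ a) x" for a
        by (rule pd_cong(1)[OF open_dom[OF c d] x]) (simp add: push)
      then show ?thesis
        by (simp add: cov_deriv_along_def cov_along_def vec_eq_iff christoffel_vec_def push[OF x] dir_deriv_vec_def[of _ "frame (?F c d) j"] dir_deriv_axis)
    qed
    ultimately show ?thesis
      by (simp add: second_fundamental_def push[OF x])
  qed
  have id_manifold: "continuous_map XM XM id" by simp
  \<comment> \<open>Near a point of two source charts, both representations of \<open>f\<close> in a single chart of the target are defined, and they are related by the transition map.\<close>
  have change: "\<exists>d\<in>N. \<exists>W. open W \<and> x \<in> W \<and> W \<subseteq> ?U c d \<and> smooth_vec_on W (coord_rep id c c') \<and>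
      coord_rep id c c' ` W \<subseteq> ?U c' d \<and> (\<forall>y\<in>W. ?F c d y = ?F c' d (coord_rep id c c' y))"
    if c: "c \<in> M" and c': "c' \<in> M" and x: "x \<in> coord_dom id c c'" for c c' x
  proof -
    obtain d where d: "d \<in> N" "x \<in> ?U c d"
      using cover[OF c] x coord_dom_subset by blast
    let ?W = "coord_dom id c c' \<inter> ?U c d"
    have "coord_rep id c c' y \<in> ?U c' d \<and> ?F c d y = ?F c' d (coord_rep id c c' y)" if y: "y \<in> ?W" for y
    proof -
      obtain p where p: "p \<in> fst c" "p \<in> fst c'" "y = snd c p" using y by (auto simp: coord_dom_def)
      have "f p \<in> fst d"
        using y p chart_inj_on[OF manifold_M c] by (auto simp: coord_dom_def dest: inj_onD)
      then show ?thesis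
        using p by (auto simp: coord_rep_apply[OF manifold_M c] coord_rep_apply[OF manifold_M c'] coord_dom_def)
    qed
    moreover have "smooth_vec_on (coord_dom id c c') (coord_rep id c c')"
      using manifold_M c c' by (simp add: smooth_manifold_def)
    then have "smooth_vec_on ?W (coord_rep id c c')"
      by (rule smooth_vec_on_subset) (rule Int_lower1)
    moreover have "open ?W"
      using open_coord_dom[OF manifold_M c manifold_M c' id_manifold] open_dom[OF c d(1)] by blast
    ultimately show ?thesis using d x by (intro bexI[of _ d] exI[of _ ?W]) auto
  qed
  show ?thesis
    unfolding coupled_projectively_flat_def
  proof (intro conjI ballI allI)
    show "trace_free3 M h P" by (rule mean_curv_zero)
    show "pseudo_riemannian_metric M h"
      unfolding pseudo_riemannian_metric_def cov2_field_def
    proof (intro conjI ballI)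
      show "nondegenerate2 M h" by (rule nondeg)
      show "smooth_comps2 M h"
        unfolding smooth_comps2_def
      proof (intro ballI allI, rule smooth_on_local)
        fix c i j x assume c: "c \<in> M" and "x \<in> chart_image c"
        then obtain d where d: "d \<in> N" "x \<in> ?U c d" using cover by blast
        show "\<exists>T. x \<in> T \<and> smooth_on T (\<lambda>x. h c x $ i $ j)"
          by (rule exI[of _ "?U c d"]) (rule conjI[OF d(2) lagrangian_domain.smooth_induced[OF L[OF c d(1)]]])
      qed
      show "transpose (h c x) = h c x" if "c \<in> M" "x \<in> chart_image c" for c x
      proof -
        obtain d where d: "d \<in> N" "x \<in> ?U c d" using cover \<open>c \<in> M\<close> \<open>x \<in> chart_image c\<close> by blast
        interpret lagrangian_domain "chart_image d" "G d" "A d" "\<Omega> d" \<epsilon> "?U c d" "?F c d" "h c" chat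
          by (rule L[OF \<open>c \<in> M\<close> d(1)])
        show ?thesis by (rule induced.metric_sym[OF d(2)])
      qed
      show "is_pullback2 M M id h h"
        unfolding is_pullback2_def Let_def
      proof (intro ballI)
        fix c c' x assume c: "c \<in> M" and c': "c' \<in> M" and x: "x \<in> coord_dom id c c'"
        obtain d W where d: "d \<in> N" and W: "open W" "x \<in> W" "W \<subseteq> ?U c d" "smooth_vec_on W (coord_rep id c c')"
          "coord_rep id c c' ` W \<subseteq> ?U c' d" and comp: "\<And>y. y \<in> W \<Longrightarrow> ?F c d y = ?F c' d (coord_rep id c c' y)"
          using change[OF c c' x] by blast
        let ?\<phi> = "coord_rep id c c'"
        have "?\<phi> x \<in> ?U c' d" "x \<in> ?U c d" using W by auto
        have J: "jacobian (?F c d) (at x) = jacobian (?F c' d) (at (?\<phi> x)) ** jacobian ?\<phi> (at x)"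
          by (rule jacobian_compose[where W = W and F = "?F c d" and F' = "?F c' d" and \<phi> = ?\<phi>, OF W(1,2) comp]) (auto intro: smooth_vec_on_vec_differentiable[OF W(4) W(2)]
              smooth_vec_on_vec_differentiable[OF smooth[OF c' d] \<open>?\<phi> x \<in> ?U c' d\<close>] smooth_vec_on_vec_differentiable[OF smooth[OF c d] \<open>x \<in> ?U c d\<close>])
        have hc: "h c x = transpose (jacobian (?F c d) (at x)) ** G d (?F c d x) ** jacobian (?F c d) (at x)"
          using induced c d \<open>x \<in> ?U c d\<close> by (simp add: is_pullback2_def Let_def)
        have hc': "h c' (?\<phi> x) = transpose (jacobian (?F c' d) (at (?\<phi> x))) ** G d (?F c' d (?\<phi> x)) ** jacobian (?F c' d) (at (?\<phi> x))"
          using induced c' d \<open>?\<phi> x \<in> ?U c' d\<close> by (simp add: is_pullback2_def Let_def)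
        show "h c x = transpose (jacobian ?\<phi> (at x)) ** h c' (?\<phi> x) ** jacobian ?\<phi> (at x)"
          unfolding hc hc' J comp[OF W(2)] by (simp add: matrix_transpose_mul matrix_mul_assoc)
      qed
    qed
    show "sym3_field M P"
      unfolding sym3_field_def cov3_field_def
    proof (intro conjI ballI allI)
      show "smooth_on (chart_image c) (\<lambda>x. P c x i j k)" if c: "c \<in> M" for c i j k
      proof (rule smooth_on_local)
        fix x assume "x \<in> chart_image c"
        then obtain d where d: "d \<in> N" "x \<in> ?U c d" using cover c by blast
        have "smooth_on (?U c d) (\<lambda>x. P c x i j k)"
          by (rule iffD2[OF smooth_on_cong[OF open_dom[OF c d(1)]]], erule P[OF c d(1)])
             (rule lagrangian_domain.smooth_second_fundamental[OF L[OF c d(1)]])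
        then show "\<exists>T. x \<in> T \<and> smooth_on T (\<lambda>x. P c x i j k)" using d by blast
      qed
      fix c x i j k assume c: "c \<in> M" and x: "x \<in> chart_image c"
      then obtain d where d: "d \<in> N" "x \<in> ?U c d" using cover by blast
      interpret lagrangian_domain "chart_image d" "G d" "A d" "\<Omega> d" \<epsilon> "?U c d" "?F c d" "h c" chat
        by (rule L[OF c d(1)])
      show "P c x i j k = P c x j i k" "P c x i j k = P c x i k j"
        unfolding P[OF c d] by (rule second_fundamental_sym12[OF d(2)], rule second_fundamental_sym23[OF d(2)])
    next
      fix c c' x i j k assume c: "c \<in> M" and c': "c' \<in> M" and x: "x \<in> coord_dom id c c'"
      obtain d W where d: "d \<in> N" and W: "open W" "x \<in> W" "W \<subseteq> ?U c d" "smooth_vec_on W (coord_rep id c c')"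
        "coord_rep id c c' ` W \<subseteq> ?U c' d" and comp: "\<And>y. y \<in> W \<Longrightarrow> ?F c d y = ?F c' d (coord_rep id c c' y)"
        using change[OF c c' x] by blast
      let ?\<phi> = "coord_rep id c c'"
      have in_U: "?\<phi> x \<in> ?U c' d" "x \<in> ?U c d" using W by auto
      have entry: "jacobian ?\<phi> (at x) $ p $ i = frame ?\<phi> i x $ p" for p i
        by (simp add: jacobian_entry[OF smooth_vec_on_vec_differentiable[OF W(4) W(2)]] dir_deriv_vec_def dir_deriv_axis)
      show "let J = jacobian ?\<phi> (at x) in P c x i j k = (\<Sum>p\<in>UNIV. \<Sum>q\<in>UNIV. \<Sum>r\<in>UNIV.
          P c' (?\<phi> x) p q r * J $ p $ i * J $ q $ j * J $ r $ k)"
        unfolding Let_def P[OF c d in_U(2)] P[OF c' d in_U(1)] entry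
        by (rule second_fundamental_transform[OF L[OF c d] L[OF c' d] W comp])
    qed
    fix c x i j k l assume c: "c \<in> M" and x: "x \<in> chart_image c"
    then obtain d where d: "d \<in> N" "x \<in> ?U c d" using cover by blast
    interpret lagrangian_domain "chart_image d" "G d" "A d" "\<Omega> d" \<epsilon> "?U c d" "?F c d" "h c" chat
      by (rule L[OF c d(1)])
    have Px: "P c x = second_fundamental x"
      using P[OF c d] by (intro ext)
    have "pd a (\<lambda>y. P c y i j k) x = pd a (\<lambda>y. second_fundamental y i j k) x" for a i j k
      by (rule pd_cong(1)[OF open_dom[OF c d(1)] d(2) P[OF c d(1)]])
    then have "cov_deriv3 (h c) (P c) x i j k l = cov_deriv3 (h c) second_fundamental x i j k l" for i j k l
      by (simp add: cov_deriv3_def Px)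
    then show "cov_deriv3 (h c) (P c) x i j k l = cov_deriv3 (h c) (P c) x j i k l"
      using codazzi_equation[OF d(2)] by simp
    have "chat * real CARD('n) * (real CARD('n) - 1) / (real CARD('n) * (real CARD('n) - 1)) = chat"
      using dim_M by simp
    then show "Riem (h c) x i j k l - \<epsilon> * cubic_square (h c x) (P c x) i j k l =
        - (chat * real CARD('n) * (real CARD('n) - 1) / (real CARD('n) * (real CARD('n) - 1))) *
          metric_square (h c x) i j k l"
      using gauss_equation[OF d(2), of i j k l] by (simp add: Px)
  qed
qed

end
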